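(* Let $m=1$ and fix integers $n\ge1$, $k_1,k_2\ge0$ and $C>1$. If $\delta\to0^+$ while $1/C\le\kappa\le C$, then \[p_{1,k_1,k_2}(x,t)=\frac{(-1)^{k_2}\pi^{k_1+k_2}}{4^n(\pi\delta)^{n+k_1-1}}e^{-\frac14d(x,t)^2}e^{-\kappa}I_{n+k_1-1}(\kappa)\big[1+O(\delta)\big].\] When $\kappa\to0^+$ and $|t|\to+\infty$, \[p_{1,k_1,k_2}(x,t)=\frac{(-1)^{k_2}\pi^{k_1+k_2}}{4^n(n+k_1-1)!}|t|^{n+k_1-1}e^{-\frac14d(x,t)^2}\Big[1+O\Big(\frac1{|t|}+\kappa\Big)\Big].\]
   Context: For integers $n,m\ge1$, $k_1,k_2\ge0$ and $(x,t)\in\mathbb{R}^{2n}\times\mathbb{R}^m$, with $u_1$ the first standard basis vector of $\mathbb{R}^m$, define \[p_{1,k_1,k_2}(x,t)=\frac{(-1)^{k_1}i^{k_2}}{(4\pi)^n(2\pi)^m}\int_{\mathbb{R}^m}e^{i|t|(\lambda,u_1)-\frac{|x|^2}{4}|\lambda|\coth|\lambda|}\frac{|\lambda|^{n+k_1}\cosh(|\lambda|)^{k_1}}{\sinh(|\lambda|)^{n+k_1}}(\lambda,u_1)^{k_2}\,d\lambda .\] Set $R=|x|^2/4$, $\omega=|t|/R$, $\delta=\sqrt{R/(\pi|t|)}$, $\kappa=2\sqrt{\pi|t|R}$. Let $\theta:(-\pi,\pi)\to\mathbb{R}$, $\theta(\lambda)=\frac{2\lambda-\sin(2\lambda)}{2\sin^2\lambda}$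 for $\lambda\ne0$, $\theta(0)=0$, $y_\omega=\theta^{-1}(\omega)$, and $d(x,t)=|x|\,y_\omega/\sin(y_\omega)$ if $x\ne0,t\ne0$; $d(x,0)=|x|$; $d(0,t)=\sqrt{4\pi|t|}$. $I_\nu$ is the modified Bessel function of integer order $\nu$, $I_\nu(\zeta)=\sum_{k\ge0}\frac{\zeta^{2k+\nu}}{2^{2k+\nu}k!\,\Gamma(k+\nu+1)}$. *)

theory Defs
  imports "HOL-Analysis.Analysis"
begin

text \<open>Heat-kernel derivative p_{1,k1,k2} for m = 1 (so lambda ranges over the reals,
  (lambda,u_1) = lambda). The point x lies in R^{2n}; only its norm enters.
  coth is written as cosh/sinh; the integrand's value at lambda = 0 is irrelevant
  (null set).\<close>
definition p1 :: "nat \<Rightarrow> nat \<Rightarrow> nat \<Rightarrow> 'a::real_normed_vector \<Rightarrow> real \<Rightarrow> complex" where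
  "p1 n k1 k2 x t =
     ((-1) ^ k1 * \<i> ^ k2 / complex_of_real ((4 * pi) ^ n * (2 * pi))) *
     (LBINT l. exp (\<i> * complex_of_real (\<bar>t\<bar> * l)
                     - complex_of_real ((norm x)\<^sup>2 / 4 * \<bar>l\<bar> * (cosh \<bar>l\<bar> / sinh \<bar>l\<bar>)))
               * complex_of_real (\<bar>l\<bar> ^ (n + k1) * cosh \<bar>l\<bar> ^ k1 / sinh \<bar>l\<bar> ^ (n + k1))
               * complex_of_real (l ^ k2))"

definition Rpar :: "'a::real_normed_vector \<Rightarrow> real" where
  "Rpar x = (norm x)\<^sup>2 / 4"

definition omega_par :: "'a::real_normed_vector \<Rightarrow> real \<Rightarrow> real" where
  "omega_par x t = \<bar>t\<bar> / Rpar x"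

definition delta_par :: "'a::real_normed_vector \<Rightarrow> real \<Rightarrow> real" where
  "delta_par x t = sqrt (Rpar x / (pi * \<bar>t\<bar>))"

definition kappa_par :: "'a::real_normed_vector \<Rightarrow> real \<Rightarrow> real" where
  "kappa_par x t = 2 * sqrt (pi * \<bar>t\<bar> * Rpar x)"

definition theta_fn :: "real \<Rightarrow> real" where
  "theta_fn l = (if l = 0 then 0 else (2 * l - sin (2 * l)) / (2 * (sin l)\<^sup>2))"

definition theta_inv :: "real \<Rightarrow> real" where
  "theta_inv w = (THE y. - pi < y \<and> y < pi \<and> theta_fn y = w)"

definition dist_d :: "'a::real_normed_vector \<Rightarrow> real \<Rightarrow> real" where
  "dist_d x t =
     (if x \<noteq> 0 \<and> t \<noteq> 0 then
        (let y = theta_inv (omega_par x t) in norm x * y / sin y)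
      else if t = 0 then norm x
      else sqrt (4 * pi * \<bar>t\<bar>))"

definition bessel_I :: "nat \<Rightarrow> real \<Rightarrow> real" where
  "bessel_I nu z = (\<Sum>k. z ^ (2 * k + nu) / (2 ^ (2 * k + nu) * fact k * Gamma (real (k + nu + 1))))"

end

theory Submission
  imports Defs "HOL-Complex_Analysis.Complex_Analysis" "HOL-Probability.Sinc_Integral"
    "HOL-Real_Asymp.Real_Asymp"
begin

text \<open>
  The integrand extends to a function of \<open>\<lambda>\<close> holomorphic in \<open>-\<pi> < Im \<lambda> < 2\<pi>\<close> apart from an essential
  singularity at \<open>i\<pi>\<close>. Moving the contour from the real line to \<open>Im \<lambda> = 3\<pi>/2\<close> leaves an integral of
  size \<open>exp (-3\<pi>|t|/2)\<close>, which is negligible, plus the residue at \<open>i\<pi>\<close>. On the circle of radius \<open>1/|t|\<close>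
  about \<open>i\<pi>\<close> the integrand is, up to a factor \<open>1 + O(1/|t| + R)\<close>, a constant times
  \<open>exp (a w + b/w) / w^N\<close> with \<open>a = i|t|\<close>, \<open>b = -i\<pi>R\<close>, \<open>N = n + k1\<close>, whose residue is a modified
  Bessel function of \<open>2 \<surd>(ab) = \<kappa>\<close>. This gives the factor \<open>exp (-\<pi>|t|)\<close> in place of
  \<open>exp (-d\<^sup>2/4)\<close>, and the two are compared through \<open>d\<^sup>2/4 = \<pi>|t| - \<kappa> + O(R)\<close>. Both asymptotic regimes
  follow from the same estimate, since \<open>R = \<kappa>\<delta>/2\<close> and \<open>|t| = \<kappa>/(2\<pi>\<delta>)\<close>.
\<close>

section \<open>The distance for small \<open>\<delta>\<close>\<close>

text \<open>A collision dictates the method. The critical point of the phase on the imaginary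
  segment below i pi lies at distance about pi \<delta> = \<kappa> / (2 |t|) from the essential
  singularity. The radius 1/|t| gives |a w| = 1 and |b / w| = pi R |t| = \<kappa>^2 / 4, hence a
  bounded exponential on the whole circle, uniformly as \<kappa> tends to 0. The height 3 pi / 2 is
  midway between the singularities i pi and 2 i pi. There |sinh z| = cosh (Re z), so no denominator
  is small, and sin (2 Im z) = 0, so Re (z coth z) is nonnegative. The factor depending on R then
  has modulus at most 1, and the remainder is uniform in R. The angle y_\<omega> is never expanded.
  It maximises an explicit phase with maximum d^2 / 4, so a trial point bounds d from below and the
  arithmetic-geometric mean inequality bounds it from above.\<close>

lemma theta_fn_eq: "sin y \<noteq> 0 \<Longrightarrow> theta_fn y = y / (sin y)\<^sup>2 - cot y"
  unfolding theta_fn_def sin_double by (auto simp: cot_def field_simps power2_eq_square)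

lemma sin_gt_mult_cos:
  fixes x :: real
  assumes "0 < x" "x < pi"
  shows "x * cos x < sin x"
proof -
  have "(\<lambda>x. sin x - x * cos x) 0 < (\<lambda>x. sin x - x * cos x) x"
  proof (rule DERIV_pos_imp_increasing_open[OF assms(1)])
    fix y :: real assume y: "0 < y" "y < x"
    then have "((\<lambda>x. sin x - x * cos x) has_real_derivative y * sin y) (at y)"
      by (auto intro!: derivative_eq_intros)
    moreover have "0 < y * sin y" using y assms by (simp add: sin_gt_zero)
    ultimately show "\<exists>d. ((\<lambda>x. sin x - x * cos x) has_real_derivative d) (at y) \<and> 0 < d" by blast
  qed (auto intro!: continuous_intros)
  then show ?thesis by simp
qed

lemma theta_fn_deriv:
  assumes "0 < y" "y < pi"
  shows "(theta_fn has_real_derivative 2 * (sin y - y * cos y) / sin y ^ 3) (at y)"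
proof -
  have s: "sin y > 0" using assms by (simp add: sin_gt_zero)
  have "((\<lambda>y. y / (sin y)\<^sup>2 - cot y) has_real_derivative 2 * (sin y - y * cos y) / sin y ^ 3) (at y)"
  proof (rule DERIV_cong)
    show "((\<lambda>y. y / (sin y)\<^sup>2 - cot y) has_real_derivative
      (1 * (sin y)\<^sup>2 - y * (2 * sin y * cos y)) / ((sin y)\<^sup>2 * (sin y)\<^sup>2) - - inverse ((sin y)\<^sup>2)) (at y)"
      by (intro DERIV_diff DERIV_divide DERIV_ident DERIV_cot)
        (use s in \<open>auto intro!: derivative_eq_intros\<close>)
  qed (use s in \<open>simp add: field_simps power2_eq_square power3_eq_cube\<close>)
  moreover have "\<forall>\<^sub>F x in nhds y. theta_fn x = x / (sin x)\<^sup>2 - cot x"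
  proof -
    have "\<forall>\<^sub>F x in nhds y. x \<in> {0<..<pi}"
      by (rule eventually_nhds_in_open) (use assms in auto)
    then show ?thesis
      by eventually_elim (simp add: theta_fn_eq sin_gt_zero less_imp_neq[symmetric])
  qed
  ultimately show ?thesis by (subst DERIV_cong_ev[OF refl _ refl])
qed

lemma theta_fn_strict_mono:
  assumes "0 < a" "a < b" "b < pi"
  shows "theta_fn a < theta_fn b"
proof (rule DERIV_pos_imp_increasing[OF assms(2)])
  fix y assume "a \<le> y" "y \<le> b"
  then have y: "0 < y" "y < pi" using assms by auto
  have "0 < 2 * (sin y - y * cos y) / sin y ^ 3"
    using y sin_gt_mult_cos[of y] sin_gt_zero[of y] by simp
  then show "\<exists>d. (theta_fn has_real_derivative d) (at y) \<and> 0 < d"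
    using theta_fn_deriv[OF y] by blast
qed

lemma theta_fn_nonpos: "y \<le> 0 \<Longrightarrow> theta_fn y \<le> 0"
  using sin_x_ge_neg_x by (auto simp: theta_fn_def intro!: divide_nonpos_nonneg)
    (smt (verit) sin_minus sin_x_le_x)

text \<open>The definite description in \<open>theta_inv\<close> needs existence and uniqueness.
  Existence is the intermediate value theorem on an interval starting at pi/2, where
  \<open>theta_fn\<close> equals pi/2. Uniqueness is strict monotonicity on (0, pi), since
  nonpositive arguments give nonpositive values.\<close>

lemma theta_inv_props:
  assumes "pi / 2 < w"
  shows "pi / 2 < theta_inv w" "theta_inv w < pi" "theta_fn (theta_inv w) = w"
proof -
  \<comment> \<open>Chosen so that \<open>pi / 2 / z\<^sup>2 = w\<close>: with sin z \<le> z and pi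
    - z \<ge> pi/2, the value of \<open>theta_fn\<close> at pi - z is already at least w.\<close>
  define z where "z = sqrt (pi / 2 / w)"
  have w: "w > 0" using assms pi_gt_zero by linarith
  have z: "0 < z" "z\<^sup>2 = pi / 2 / w" using w by (auto simp: z_def)
  have "z\<^sup>2 < 1" using assms w by (simp add: z)
  then have z1: "z < 1" by (simp add: power_less_one_iff z(1) power2_less_imp_less)
  have pi2: "1 < pi / 2" using pi_gt3 by simp
  have half: "theta_fn (pi / 2) = pi / 2" by (simp add: theta_fn_eq cot_def)
  have sz: "0 < sin z" using z z1 pi2 by (intro sin_gt_zero) auto
  have "w = pi / 2 / z\<^sup>2" using w by (simp add: z)
  also have "\<dots> \<le> (pi - z) / (sin z)\<^sup>2"
    using z(1) z1 pi2 sz sin_x_le_x[of z] by (intro frac_le) (auto simp del: z(2) intro!: power_mono)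
  also have "\<dots> \<le> (pi - z) / (sin z)\<^sup>2 + cot z"
    using sz z z1 pi2 by (auto simp: cot_def intro!: divide_nonneg_pos cos_ge_zero)
  also have "\<dots> = theta_fn (pi - z)"
    using sz by (subst theta_fn_eq) (auto simp: cot_def)
  finally have up: "w \<le> theta_fn (pi - z)" .
  have "\<exists>y. pi / 2 \<le> y \<and> y \<le> pi - z \<and> theta_fn y = w"
  proof (rule IVT)
    show "\<forall>x. pi / 2 \<le> x \<and> x \<le> pi - z \<longrightarrow> isCont theta_fn x"
      using z pi2 by (auto intro!: DERIV_isCont[OF theta_fn_deriv])
  qed (use assms half up z1 pi2 in auto)
  then obtain y where y: "pi / 2 \<le> y" "y \<le> pi - z" "theta_fn y = w" by blast
  have y': "- pi < y" "y < pi" "0 < y" using y z pi2 by auto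
  have "theta_inv w = y"
    unfolding theta_inv_def
  proof (rule the_equality)
    fix u assume u: "- pi < u \<and> u < pi \<and> theta_fn u = w"
    with theta_fn_nonpos[of u] w have "0 < u" by force
    then show "u = y"
      using u y y' theta_fn_strict_mono[of u y] theta_fn_strict_mono[of y u] by force
  qed (use y y' in auto)
  moreover have "y \<noteq> pi / 2" using half y(3) assms by fastforce
  ultimately show "pi / 2 < theta_inv w" "theta_inv w < pi" "theta_fn (theta_inv w) = w"
    using y y' by auto
qed

text \<open>At the critical point the phase equals \<open>d\<^sup>2/4\<close>, so any trial point bounds the distance from below.\<close>
lemma phase_le_max:
  fixes R \<tau> s y :: real
  assumes R: "0 < R" and y: "0 < y" "y < pi" and s: "0 < s" "s < pi"
    and crit: "theta_fn y = \<tau> / R"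
  shows "\<tau> * s + R * s * cot s \<le> \<tau> * y + R * y * cot y"
proof -
  let ?\<phi> = "\<lambda>s. \<tau> * s + R * s * cot s"
  \<comment> \<open>As \<open>theta_fn\<close> increases and equals \<tau>/R at y, this derivative
    passes from nonnegative to nonpositive at y, which makes y a global maximum on (0, pi).\<close>
  have d: "(?\<phi> has_real_derivative \<tau> - R * theta_fn u) (at u)" if "0 < u" "u < pi" for u
  proof -
    have "sin u > 0" using that by (simp add: sin_gt_zero)
    then show ?thesis
      by (auto intro!: derivative_eq_intros DERIV_cot simp: theta_fn_eq field_simps power2_eq_square)
  qed
  have t: "\<tau> = R * theta_fn y" using crit R by simp
  consider "s < y" | "s = y" | "y < s" by linarith
  then show ?thesis
  proof cases
    case 1
    have "?\<phi> s \<le> ?\<phi> y"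
    proof (rule DERIV_nonneg_imp_nondecreasing[where f = "?\<phi>"])
      fix u assume u: "s \<le> u" "u \<le> y"
      then have "theta_fn u \<le> theta_fn y"
        using s y theta_fn_strict_mono[of u y] by (cases "u = y") auto
      then have "0 \<le> \<tau> - R * theta_fn u" using R t by simp
      then show "\<exists>d. (?\<phi> has_real_derivative d) (at u) \<and> 0 \<le> d"
        using d[of u] u s y by fastforce
    qed (use 1 in simp)
    then show ?thesis .
  next
    case 3
    have "?\<phi> s \<le> ?\<phi> y"
    proof (rule DERIV_nonpos_imp_nonincreasing[where f = "?\<phi>"])
      fix u assume u: "y \<le> u" "u \<le> s"
      then have "theta_fn y \<le> theta_fn u"
        using s y theta_fn_strict_mono[of y u] by (cases "u = y") auto
      then have "\<tau> - R * theta_fn u \<le> 0" using R t by simp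
      then show "\<exists>d. (?\<phi> has_real_derivative d) (at u) \<and> d \<le> 0"
        using d[of u] u s y by fastforce
    qed (use 3 in simp)
    then show ?thesis .
  qed simp
qed

text \<open>Allows cot z to be replaced by its polar part 1/z at bounded cost. The last bound rests
  on sin z + cos z \<ge> 1 in the first quadrant together with sin z \<le> z.\<close>

lemma inverse_minus_cot_bounds:
  fixes z :: real
  assumes "0 < z" "z < pi / 2"
  shows "0 \<le> cot z" "cot z \<le> 1 / z" "1 / z - cot z \<le> 1"
proof -
  have sz: "0 < sin z" and cz: "0 < cos z"
    using assms by (auto intro: sin_gt_zero cos_gt_zero)
  show "0 \<le> cot z" using sz cz by (simp add: cot_def)
  have le: "z * cos z \<le> sin z" using sin_gt_mult_cos[of z] assms by simp
  then show "cot z \<le> 1 / z" using sz assms by (simp add: cot_def field_simps)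
  have "1 \<le> sin z + cos z"
  proof -
    have "(sin z + cos z)\<^sup>2 = 1 + 2 * sin z * cos z"
      by (simp add: power2_sum)
    also have "\<dots> \<ge> 1\<^sup>2" using sz cz by simp
    finally show ?thesis using sz cz by (smt (verit) power2_le_imp_le)
  qed
  moreover have "sin z \<le> z" using sin_x_le_x assms by simp
  ultimately have "z \<le> z * sin z + z * cos z" "sin z \<le> z"
    using assms by (auto simp: distrib_left[symmetric])
  then show "1 / z - cot z \<le> 1" using sz assms by (simp add: cot_def field_simps)
qed

text \<open>At s = pi - z the phase is pi \<tau> - (\<tau> z + R pi / z) up to O(R). The bracket has
  minimum 2 sqrt (pi R \<tau>) = \<kappa>, attained at z0 = pi \<delta>; the smallness hypothesis
  says z0 < 1.\<close>

lemma dist_d_bounds: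
  fixes x :: "'a::real_normed_vector" and t :: real
  assumes x: "x \<noteq> 0" and t: "t \<noteq> 0" and small: "delta_par x t < 1 / pi"
  shows "pi * \<bar>t\<bar> - kappa_par x t \<le> (dist_d x t)\<^sup>2 / 4"
    and "(dist_d x t)\<^sup>2 / 4 \<le> pi * \<bar>t\<bar> - kappa_par x t + 5 * Rpar x"
proof -
  define R \<tau> z0 where "R = Rpar x" and "\<tau> = \<bar>t\<bar>" and "z0 = pi * delta_par x t"
  define y where "y = theta_inv (\<tau> / R)"
  define z where "z = pi - y"
  have pi2: "1 < pi / 2" using pi_gt3 by simp
  have R: "R > 0" and tau: "\<tau> > 0" using x t by (auto simp: R_def Rpar_def \<tau>_def)
  have z0: "0 < z0" "z0 < 1" using R tau small by (auto simp: z0_def delta_par_def R_def[symmetric] \<tau>_def[symmetric] field_simps)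
  have z0sq: "z0\<^sup>2 = pi * R / \<tau>"
    using R tau by (simp add: z0_def delta_par_def R_def[symmetric] \<tau>_def[symmetric] power_mult_distrib field_simps power2_eq_square)
  have kap: "kappa_par x t = 2 * (\<tau> * z0)"
  proof -
    have "(\<tau> * z0)\<^sup>2 = pi * \<tau> * R" using z0sq tau by (simp add: power_mult_distrib field_simps power2_eq_square)
    then have "\<tau> * z0 = sqrt (pi * \<tau> * R)" using tau z0 by (metis less_imp_le mult_nonneg_nonneg real_sqrt_unique)
    then show ?thesis by (simp add: kappa_par_def R_def \<tau>_def)
  qed
  \<comment> \<open>The two terms of \<tau> z + R pi / z coincide at z0: the equality case of the
    mean inequality.\<close>
  have kap': "R * pi / z0 = \<tau> * z0" using z0sq z0 tau R by (simp add: field_simps power2_eq_square)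
  have "z0\<^sup>2 < 1" using z0 by (simp add: power_less_one_iff)
  then have "pi * R < \<tau>" using z0sq tau by (simp add: field_simps)
  then have "pi < \<tau> / R" using R by (simp add: field_simps)
  then have "pi / 2 < \<tau> / R" using pi2 by linarith
  note y = theta_inv_props[OF this, folded y_def]
  have sy: "0 < sin y" using y pi2 by (intro sin_gt_zero) auto
  have "(dist_d x t)\<^sup>2 / 4 = R * y\<^sup>2 / (sin y)\<^sup>2"
    using x t by (simp add: dist_d_def omega_par_def R_def[symmetric] \<tau>_def[symmetric] y_def[symmetric] power_mult_distrib power_divide)
      (simp add: R_def Rpar_def)
  also have "\<dots> = \<tau> * y + R * y * cot y"
  proof -
    have \<tau>: "\<tau> = R * (y / (sin y)\<^sup>2 - cot y)" using y R sy by (simp flip: theta_fn_eq)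
    show ?thesis unfolding \<tau> by (simp add: algebra_simps power2_eq_square)
  qed
  finally have d: "(dist_d x t)\<^sup>2 / 4 = \<tau> * y + R * y * cot y" .
  have cotz: "cot y = - cot z" using sy by (simp add: z_def cot_def)
  have z: "0 < z" "z < pi / 2" using y by (auto simp: z_def)
  note b = inverse_minus_cot_bounds[OF z]
  have z0': "0 < z0" "z0 < pi / 2" using z0 pi2 by auto
  note b0 = inverse_minus_cot_bounds[OF z0']
  \<comment> \<open>Lower bound: pi - z0 serves as the trial point, and both errors made in
    replacing cot have the favourable sign.\<close>
  have "pi * \<tau> - 2 * (\<tau> * z0) = pi * \<tau> - \<tau> * z0 - R * pi / z0" using kap' by simp
  also have "\<dots> \<le> pi * \<tau> - \<tau> * z0 - R * pi * cot z0 + R * z0 * cot z0"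
  proof -
    have "R * pi * cot z0 \<le> R * pi / z0" using mult_left_mono[OF b0(2), of "R * pi"] R by simp
    moreover have "0 \<le> R * z0 * cot z0" using R b0 z0 by simp
    ultimately show ?thesis by linarith
  qed
  also have "\<dots> = \<tau> * (pi - z0) + R * (pi - z0) * cot (pi - z0)"
    by (simp add: cot_def algebra_simps)
  also have "\<dots> \<le> \<tau> * y + R * y * cot y"
    using R y pi2 z0 by (intro phase_le_max) auto
  finally show "pi * \<bar>t\<bar> - kappa_par x t \<le> (dist_d x t)\<^sup>2 / 4" using d kap by (simp add: \<tau>_def)
  \<comment> \<open>Upper bound: at the true z, whatever it is, \<tau> z + R pi / z is at least 2
    \<tau> z0. The cotangent errors cost R pi + R, and pi < 4 gives the constant 5.\<close>
  have "\<tau> * y + R * y * cot y = pi * \<tau> - \<tau> * z - R * pi * cot z + R * (z * cot z)"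
    using cotz by (simp add: z_def algebra_simps)
  also have "\<dots> \<le> pi * \<tau> - \<tau> * z - R * pi * (1 / z - 1) + R * 1"
  proof -
    have "R * pi * (1 / z - 1) \<le> R * pi * cot z" using R b by (intro mult_left_mono) auto
    moreover have "R * (z * cot z) \<le> R * 1" using R b z by (intro mult_left_mono) (auto simp: field_simps)
    ultimately show ?thesis by linarith
  qed
  also have "\<dots> \<le> pi * \<tau> - 2 * (\<tau> * z0) + 5 * R"
  proof -
    have "2 * (\<tau> * z0) \<le> \<tau> * z + R * pi / z"
    proof -
      have "0 \<le> \<tau> * (z - z0)\<^sup>2 / z" using tau z by simp
      also have "\<dots> = \<tau> * z - 2 * (\<tau> * z0) + \<tau> * z0\<^sup>2 / z"
        using z by (simp add: power2_eq_square field_simps)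
      also have "\<tau> * z0\<^sup>2 = R * pi" using z0sq tau by simp
      finally show ?thesis by simp
    qed
    moreover have "R * pi \<le> R * 4" using R pi_less_4 by (intro mult_left_mono) auto
    ultimately show ?thesis by (simp add: algebra_simps)
  qed
  finally show "(dist_d x t)\<^sup>2 / 4 \<le> pi * \<bar>t\<bar> - kappa_par x t + 5 * Rpar x"
    using d kap by (simp add: \<tau>_def R_def)
qed

section \<open>The complexified integrand\<close>

text \<open>The entire extension of sinh z / z. Writing z coth z as \<open>cosh z / sinhc z\<close>
  and z / sinh z as \<open>1 / sinhc z\<close> removes the spurious singularity of the integrand at
  0.\<close>

definition sinhc :: "complex \<Rightarrow> complex" where
  "sinhc z = (if z = 0 then 1 else sinh z / z)"

lemma sinh_eq_mult_sinhc: "sinh z = z * sinhc z"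
  by (simp add: sinhc_def)

lemma sinhc_0 [simp]: "sinhc 0 = 1"
  by (simp add: sinhc_def)

lemma holomorphic_sinh_cosh:
  "(sinh :: complex \<Rightarrow> complex) holomorphic_on A" "(cosh :: complex \<Rightarrow> complex) holomorphic_on A"
  unfolding sinh_def cosh_def scaleR_conv_of_real by (auto intro!: holomorphic_intros)

lemma sinhc_holomorphic: "sinhc holomorphic_on A"
proof -
  have "deriv sinh (0::complex) = 1"
    by (rule DERIV_imp_deriv) (auto intro!: derivative_eq_intros)
  then have "sinhc = (\<lambda>z. if z = 0 then deriv sinh 0 else (sinh z - sinh 0) / (z - 0))"
    by (auto simp: sinhc_def)
  moreover have "\<dots> holomorphic_on UNIV"
    by (rule pole_lemma_open) (auto intro!: holomorphic_sinh_cosh)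
  ultimately show ?thesis by (metis holomorphic_on_subset subset_UNIV)
qed

lemma holomorphic_on_sinhc [holomorphic_intros]:
  "f holomorphic_on A \<Longrightarrow> (\<lambda>z. sinhc (f z)) holomorphic_on A"
  using holomorphic_on_compose[of f A sinhc] sinhc_holomorphic by (simp add: o_def)

section \<open>Moduli of sinh and cosh, and the sign of Re (z coth z)\<close>

lemma complex_sinh_cosh_parts:
  "Re (sinh z) = sinh (Re z) * cos (Im z)" "Im (sinh z) = cosh (Re z) * sin (Im z)"
  "Re (cosh z) = cosh (Re z) * cos (Im z)" "Im (cosh z) = sinh (Re z) * sin (Im z)"
  by (simp_all add: sinh_def cosh_def Re_exp Im_exp algebra_simps)

lemma norm_sinh_sq: "(norm (sinh z))\<^sup>2 = (sinh (Re z))\<^sup>2 + (sin (Im z))\<^sup>2"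
  and norm_cosh_sq: "(norm (cosh z))\<^sup>2 = (sinh (Re z))\<^sup>2 + (cos (Im z))\<^sup>2" for z :: complex
  by (simp_all add: cmod_power2 complex_sinh_cosh_parts power_mult_distrib cosh_square_eq
      cos_squared_eq algebra_simps)

text \<open>The zeros of sinh are the integer multiples of i pi. The strip stops at -i pi and 2 i
  pi, and the zero at 0 has been divided out.\<close>

lemma sinhc_nonzero:
  assumes "- pi < Im z" "Im z < 2 * pi" "z \<noteq> \<i> * pi"
  shows "sinhc z \<noteq> 0"
proof
  assume "sinhc z = 0"
  then have z0: "z \<noteq> 0" and "sinh z = 0" by (auto simp: sinh_eq_mult_sinhc)
  then have "(sinh (Re z))\<^sup>2 + (sin (Im z))\<^sup>2 = 0" using norm_sinh_sq[of z] by simp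
  then have re: "Re z = 0" and "sin (Im z) = 0" by (auto simp: sum_power2_eq_zero_iff)
  then obtain k :: int where k: "Im z = of_int k * pi" using sin_zero_iff_int2 by auto
  then have "- 1 < real_of_int k" "real_of_int k < 2" using assms(1,2)
    by (auto simp: mult_less_cancel_right_pos dest: le_less_trans)
      (metis mult_minus1 mult_less_cancel_right_pos pi_gt_zero)
  then have "k = 0 \<or> k = 1" by linarith
  then show False using k re z0 assms(3) by (auto simp: complex_eq_iff)
qed

text \<open>Multiplying numerator and denominator by the conjugate of sinh z gives cosh z cnj (sinh
  z) = (sinh (2 Re z) - i sin (2 Im z)) / 2. The hypothesis is the resulting sign condition, which
  can be checked on each side of the contour.\<close>

lemma Re_mult_coth_nonneg:
  assumes "0 \<le> Re z * sinh (2 * Re z) + Im z * sin (2 * Im z)"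
  shows "0 \<le> Re (cosh z / sinhc z)"
proof (cases "z = 0")
  case False
  have parts: "Re (cosh z * cnj (sinh z)) = sinh (2 * Re z) / 2"
    "Im (cosh z * cnj (sinh z)) = - (sin (2 * Im z) / 2)"
  proof -
    have "Re (cosh z * cnj (sinh z))
        = sinh (Re z) * cosh (Re z) * ((cos (Im z))\<^sup>2 + (sin (Im z))\<^sup>2)"
      unfolding power2_eq_square by (simp add: complex_sinh_cosh_parts algebra_simps del: sin_cos_squared_add3)
    then show "Re (cosh z * cnj (sinh z)) = sinh (2 * Re z) / 2"
      by (simp add: sinh_double)
    have "Im (cosh z * cnj (sinh z))
        = - (sin (Im z) * cos (Im z) * ((cosh (Re z))\<^sup>2 - (sinh (Re z))\<^sup>2))"
      unfolding power2_eq_square by (simp add: complex_sinh_cosh_parts algebra_simps)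
    then show "Im (cosh z * cnj (sinh z)) = - (sin (2 * Im z) / 2)"
      by (simp add: sin_double cosh_square_eq)
  qed
  have "Re (z * (cosh z * cnj (sinh z))) = (Re z * sinh (2 * Re z) + Im z * sin (2 * Im z)) / 2"
    unfolding times_complex.simps(1)[of z] parts by (simp add: add_divide_distrib)
  \<comment> \<open>If sinh z = 0 with z nonzero, both sides are 0 by the convention for division by
    zero.\<close>
  moreover have "cosh z / sinhc z = z * (cosh z * cnj (sinh z)) / of_real ((norm (sinh z))\<^sup>2)"
    unfolding complex_norm_square using False by (cases "sinh z = 0") (simp_all add: sinhc_def)
  ultimately show ?thesis using assms by simp
qed simp

text \<open>No absolute values remain, because cosh z, z coth z and z / sinh z are even; on the
  nonzero reals this is the integrand of \<open>p1\<close>.\<close>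

definition heat_integrand :: "real \<Rightarrow> real \<Rightarrow> nat \<Rightarrow> nat \<Rightarrow> nat \<Rightarrow> complex \<Rightarrow> complex" where
  "heat_integrand R \<tau> n k1 k2 z = exp (\<i> * \<tau> * z - R * (cosh z / sinhc z))
     * (cosh z ^ k1 * z ^ k2 / sinhc z ^ (n + k1))"

lemma heat_integrand_holomorphic: "heat_integrand R \<tau> n k1 k2 holomorphic_on ({z. - pi < Im z \<and> Im z < 2 * pi} - {\<i> * pi})"
  unfolding heat_integrand_def
  by (intro holomorphic_intros holomorphic_sinh_cosh holomorphic_on_divide) (use sinhc_nonzero in auto)

text \<open>The factor involving R has modulus at most 1, so the bound is uniform in R, and raising
  the contour gains exactly exp (-\<tau> Im z).\<close>

lemma norm_heat_integrand_le:
  assumes "0 \<le> R" "0 \<le> Re z * sinh (2 * Re z) + Im z * sin (2 * Im z)"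
  shows "norm (heat_integrand R \<tau> n k1 k2 z) \<le> exp (- \<tau> * Im z) * norm (cosh z ^ k1 * z ^ k2 / sinhc z ^ (n + k1))"
proof -
  have "0 \<le> R * Re (cosh z / sinhc z)" using assms Re_mult_coth_nonneg by simp
  then have "exp (Re (\<i> * \<tau> * z - R * (cosh z / sinhc z))) \<le> exp (- \<tau> * Im z)"
    by (subst exp_le_cancel_iff) (simp del: Re_divide times_divide_eq_right)
  then show ?thesis unfolding heat_integrand_def norm_mult norm_exp_eq_Re
    by (intro mult_right_mono) auto
qed

section \<open>Decay of the amplitude along the contours\<close>

lemma power_le_fact_mult_exp:
  fixes x :: real
  assumes "0 \<le> x"
  shows "x ^ m \<le> fact m * exp x"
proof -
  have "(\<Sum>k\<in>{m}. x ^ k /\<^sub>R fact k) \<le> exp x" unfolding exp_def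
    by (rule sum_le_suminf[OF summable_exp_generic]) (use assms in auto)
  then show ?thesis by (simp add: field_simps)
qed

text \<open>Pairing the k1 factors of cosh with as many of sinh leaves a bounded power of coth. The
  other n factors 1 / sinh z decay exponentially and absorb the powers of z, with enough left for
  the integrable weight 1 / (1 + (Re z)^2).\<close>

lemma amplitude_bound:
  fixes z :: complex
  assumes c: "norm (cosh z) \<le> 2 * norm (sinh z)" and s: "exp \<bar>Re z\<bar> \<le> 4 * norm (sinh z)"
    and im: "\<bar>Im z\<bar> \<le> 5" and n: "n \<ge> 1"
  shows "norm (cosh z ^ k1 * z ^ k2 / sinhc z ^ (n + k1))
    \<le> 2 ^ k1 * 4 ^ n * fact (n + k1 + k2 + 2) * exp 5 / (1 + (Re z)\<^sup>2)"
proof -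
  let ?a = "\<bar>Re z\<bar>" and ?M = "n + k1 + k2"
  have sp: "0 < norm (sinh z)" using s exp_gt_zero[of ?a] by linarith
  then have z0: "z \<noteq> 0" by auto
  have "norm (cosh z ^ k1 * z ^ k2 / sinhc z ^ (n + k1))
      = norm z ^ ?M * ((norm (cosh z) / norm (sinh z)) ^ k1 * (1 / norm (sinh z)) ^ n)"
    using z0 by (simp add: sinhc_def norm_mult norm_divide norm_power power_add power_divide field_simps)
  also have "\<dots> \<le> (?a + 5) ^ ?M * (2 ^ k1 * (4 * exp (- ?a)) ^ n)"
  proof (intro mult_mono power_mono)
    show "norm z \<le> ?a + 5" using cmod_le[of z] im by linarith
    show "norm (cosh z) / norm (sinh z) \<le> 2" using c sp by (simp add: field_simps)
    show "1 / norm (sinh z) \<le> 4 * exp (- ?a)"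
      using s sp by (simp add: exp_minus field_simps)
  qed auto
  \<comment> \<open>One decaying exponential is enough; it exists because n \<ge> 1.\<close>
  also have "\<dots> \<le> (?a + 5) ^ ?M * (2 ^ k1 * (4 ^ n * exp (- ?a)))"
    using n power_decreasing[of 1 n "exp (- ?a)"] unfolding power_mult_distrib
    by (intro mult_left_mono) auto
  also have "\<dots> = 2 ^ k1 * 4 ^ n * (exp (- ?a) * (?a + 5) ^ ?M)" by (simp only: mult_ac)
  also have "\<dots> \<le> 2 ^ k1 * 4 ^ n * (fact (?M + 2) * exp 5 / (1 + (Re z)\<^sup>2))"
  proof (intro mult_left_mono)
    \<comment> \<open>The weight costs two more powers of \<open>?a + 5\<close>, hence the 2 in the
      factorial; exp 5 comes from the shift by 5.\<close>
    have "1 + (Re z)\<^sup>2 \<le> (?a + 5)\<^sup>2" by (simp add: power2_sum)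
    then have "(?a + 5) ^ ?M * (1 + (Re z)\<^sup>2) \<le> (?a + 5) ^ ?M * (?a + 5)\<^sup>2"
      by (intro mult_left_mono) auto
    also have "\<dots> = (?a + 5) ^ (?M + 2)" by (rule power_add[symmetric])
    also have "\<dots> \<le> fact (?M + 2) * exp (?a + 5)" by (rule power_le_fact_mult_exp) simp
    also have "\<dots> = fact (?M + 2) * exp 5 * exp ?a" by (simp add: exp_add)
    finally have *: "(?a + 5) ^ ?M * (1 + (Re z)\<^sup>2) \<le> fact (?M + 2) * exp 5 * exp ?a" .
    have "0 < 1 + (Re z)\<^sup>2" by (simp add: add_pos_nonneg)
    with * show "exp (- ?a) * (?a + 5) ^ ?M \<le> fact (?M + 2) * exp 5 / (1 + (Re z)\<^sup>2)"
      by (simp add: exp_minus field_simps del: fact_Suc)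
  qed auto
  finally show ?thesis by (simp only: mult.assoc times_divide_eq_right)
qed

text \<open>Once |Re z| \<ge> 1, sinh |Re z| is at least 1 and dominates the trigonometric terms in
  the moduli of sinh z and cosh z.\<close>

lemma amplitude_bound_far:
  assumes a: "1 \<le> \<bar>Re z\<bar>" and im: "\<bar>Im z\<bar> \<le> 5" and n: "n \<ge> 1"
  shows "norm (cosh z ^ k1 * z ^ k2 / sinhc z ^ (n + k1))
    \<le> 2 ^ k1 * 4 ^ n * fact (n + k1 + k2 + 2) * exp 5 / (1 + (Re z)\<^sup>2)"
proof (rule amplitude_bound[OF _ _ im n])
  let ?a = "\<bar>Re z\<bar>"
  have sa: "(sinh (Re z))\<^sup>2 = (sinh ?a)\<^sup>2" by (cases "0 \<le> Re z") auto
  have "2 \<le> exp ?a" using exp_ge_add_one_self[of ?a] a by linarith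
  then have "exp (- ?a) \<le> 1 / 2" by (simp add: exp_minus field_simps)
  with \<open>2 \<le> exp ?a\<close> have e: "exp ?a \<le> 4 * sinh ?a" by (simp add: sinh_def)
  have "1 \<le> sinh ?a" using real_le_x_sinh[of ?a] a by (simp add: sinh_def exp_minus)
  then have s1: "1 \<le> (sinh ?a)\<^sup>2" by (rule one_le_power)
  have "sinh ?a \<le> norm (sinh z)"
  proof (rule power2_le_imp_le)
    show "(sinh ?a)\<^sup>2 \<le> (norm (sinh z))\<^sup>2" unfolding norm_sinh_sq sa by simp
  qed simp
  with e show "exp ?a \<le> 4 * norm (sinh z)" by linarith
  have "(norm (cosh z))\<^sup>2 \<le> (2 * norm (sinh z))\<^sup>2"
  proof -
    have "(cos (Im z))\<^sup>2 \<le> 1" "0 \<le> (sin (Im z))\<^sup>2" by (simp_all add: abs_square_le_1)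
    with s1 have "(sinh ?a)\<^sup>2 + (cos (Im z))\<^sup>2 \<le> 4 * ((sinh ?a)\<^sup>2 + (sin (Im z))\<^sup>2)" by argo
    then show ?thesis
      unfolding power_mult_distrib norm_cosh_sq norm_sinh_sq sa by simp
  qed
  then show "norm (cosh z) \<le> 2 * norm (sinh z)" by (rule power2_le_imp_le) simp
qed

text \<open>On this line |sinh z| = cosh (Re z) and |cosh z| = |sinh (Re z)|, so the estimate holds
  down to Re z = 0.\<close>

lemma amplitude_bound_top:
  assumes im: "Im z = 3 * pi / 2" and n: "n \<ge> 1"
  shows "norm (cosh z ^ k1 * z ^ k2 / sinhc z ^ (n + k1))
    \<le> 2 ^ k1 * 4 ^ n * fact (n + k1 + k2 + 2) * exp 5 / (1 + (Re z)\<^sup>2)"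
proof (rule amplitude_bound[OF _ _ _ n])
  let ?a = "\<bar>Re z\<bar>"
  have "Im z = pi / 2 + pi" using im by simp
  then have sc: "sin (Im z) = - 1" "cos (Im z) = 0" by (simp_all only: sin_periodic_pi cos_periodic_pi) auto
  have "(norm (sinh z))\<^sup>2 = (cosh ?a)\<^sup>2"
    using norm_sinh_sq[of z] sc cosh_square_eq[of "Re z"] by (cases "0 \<le> Re z") auto
  then have s: "norm (sinh z) = cosh ?a" by (simp add: cosh_real_nonneg)
  have "4 * cosh ?a = 2 * exp ?a + 2 * exp (- ?a)" by (simp add: cosh_def)
  with s show "exp ?a \<le> 4 * norm (sinh z)" using exp_gt_zero[of ?a] exp_gt_zero[of "- ?a"] by linarith
  show "norm (cosh z) \<le> 2 * norm (sinh z)"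
  proof (rule power2_le_imp_le)
    show "(norm (cosh z))\<^sup>2 \<le> (2 * norm (sinh z))\<^sup>2"
      unfolding power_mult_distrib norm_cosh_sq norm_sinh_sq sc by simp
  qed simp
  show "\<bar>Im z\<bar> \<le> 5"
  proof -
    have "pi \<le> 3.2" using pi_approx by simp
    then show ?thesis unfolding im using pi_gt_zero by (intro abs_leI; argo)
  qed
qed

section \<open>Shifting the contour past \<open>i\<pi>\<close>\<close>

text \<open>One constant for all sides of the rectangle. What the explicit bounds leave open is the
  real segment near 0, settled by compactness.\<close>

lemma amplitude_bound_exists:
  assumes n: "n \<ge> 1"
  obtains B where "0 < B" "\<And>z. Im z = 0 \<or> Im z = 3 * pi / 2 \<or> 1 \<le> \<bar>Re z\<bar> \<and> \<bar>Im z\<bar> \<le> 5 \<Longrightarrow>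
    norm (cosh z ^ k1 * z ^ k2 / sinhc z ^ (n + k1)) \<le> B / (1 + (Re z)\<^sup>2)"
proof -
  let ?f = "\<lambda>z. cosh z ^ k1 * z ^ k2 / sinhc z ^ (n + k1)"
  define B0 where "B0 = 2 ^ k1 * 4 ^ n * fact (n + k1 + k2 + 2) * exp (5::real)"
  have "B0 > 0" by (simp add: B0_def)
  have "continuous_on {-1..1} (\<lambda>x::real. ?f (of_real x))"
  proof (rule continuous_on_compose2[of "{z. - pi < Im z \<and> Im z < 2 * pi} - {\<i> * pi}" ?f])
    show "continuous_on ({z. - pi < Im z \<and> Im z < 2 * pi} - {\<i> * pi}) ?f"
      by (intro holomorphic_on_imp_continuous_on holomorphic_intros holomorphic_sinh_cosh
          holomorphic_on_divide) (use sinhc_nonzero in auto)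
  qed (auto intro!: continuous_intros simp: complex_eq_iff)
  then have "bounded ((\<lambda>x::real. ?f (of_real x)) ` {-1..1})"
    by (intro compact_imp_bounded compact_continuous_image) auto
  then obtain B1 where B1: "B1 > 0" "\<And>x::real. x \<in> {-1..1} \<Longrightarrow> norm (?f (of_real x)) \<le> B1"
    by (auto simp: bounded_pos)
  \<comment> \<open>The 2 compensates for the weight, as 1 + (Re z)^2 \<le> 2 on the compact
    segment.\<close>
  define B where "B = max B0 (2 * B1)"
  show ?thesis
  proof (rule that[of B])
    show "0 < B" using \<open>B0 > 0\<close> by (simp add: B_def)
    fix z assume z: "Im z = 0 \<or> Im z = 3 * pi / 2 \<or> 1 \<le> \<bar>Re z\<bar> \<and> \<bar>Im z\<bar> \<le> 5"
    have pos: "0 < 1 + (Re z)\<^sup>2" by (simp add: add_pos_nonneg)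
    have le: "B0 / (1 + (Re z)\<^sup>2) \<le> B / (1 + (Re z)\<^sup>2)" 
      using pos by (intro divide_right_mono) (auto simp: B_def)
    consider "Im z = 3 * pi / 2" | "1 \<le> \<bar>Re z\<bar> \<and> \<bar>Im z\<bar> \<le> 5" | "Im z = 0" "\<bar>Re z\<bar> < 1"
      using z by fastforce
    then show "norm (?f z) \<le> B / (1 + (Re z)\<^sup>2)"
    proof cases
      case 1
      show ?thesis using amplitude_bound_top[OF 1 n] le unfolding B0_def by (rule order_trans)
    next
      case 2
      then show ?thesis using amplitude_bound_far[OF _ _ n, of z] le unfolding B0_def by (meson order_trans)
    next
      case 3
      then have zr: "z = of_real (Re z)" by (simp add: complex_eq_iff)
      have "(Re z)\<^sup>2 \<le> 1" using 3 by (simp add: abs_square_le_1)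
      have "norm (?f z) \<le> B1" using B1(2)[of "Re z", folded zr] 3 by (auto simp: abs_less_iff)
      also have "\<dots> \<le> B / 2" by (simp add: B_def)
      also have "\<dots> \<le> B / (1 + (Re z)\<^sup>2)"
        using pos \<open>(Re z)\<^sup>2 \<le> 1\<close> \<open>0 < B\<close> by (intro divide_left_mono) auto
      finally show ?thesis .
    qed
  qed
qed

lemma heat_integrand_continuous_on:
  "continuous_on ({z. - pi < Im z \<and> Im z < 2 * pi} - {\<i> * pi}) (heat_integrand R \<tau> n k1 k2)"
  by (rule holomorphic_on_imp_continuous_on[OF heat_integrand_holomorphic])

lemma integrable_inverse_1_plus_square_UNIV: "integrable lborel (\<lambda>x::real. B / (1 + x\<^sup>2))"
proof -
  have "integrable lborel (\<lambda>x::real. inverse (1 + x\<^sup>2))"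
    using integrable_inverse_1_plus_square by (simp add: set_integrable_def)
  then show ?thesis by (simp add: divide_inverse)
qed

lemma integral_inverse_1_plus_square_le:
  fixes L :: real
  assumes "0 \<le> L"
  shows "(\<lambda>x. 1 / (1 + x\<^sup>2)) integrable_on {-L..L}" "integral {-L..L} (\<lambda>x. 1 / (1 + x\<^sup>2)) \<le> pi"
proof -
  have "((\<lambda>x. 1 / (1 + x\<^sup>2)) has_integral (arctan L - arctan (- L))) {-L..L}"
    using assms by (intro fundamental_theorem_of_calculus)
      (auto intro!: derivative_eq_intros simp: has_real_derivative_iff_has_vector_derivative[symmetric] inverse_eq_divide)
  moreover have "arctan L - arctan (- L) \<le> pi" using arctan_bounded[of L] by (simp add: arctan_minus)
  ultimately show "(\<lambda>x. 1 / (1 + x\<^sup>2)) integrable_on {-L..L}" "integral {-L..L} (\<lambda>x. 1 / (1 + x\<^sup>2)) \<le> pi"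
    by (auto simp: integral_unique)
qed

text \<open>Residue theorem on the rectangle with base [-L, L] and height 3 pi / 2. The factor pi is
  the total mass of 1 / (1 + x^2); 10 accounts for two vertical sides, each shorter than 5.\<close>

lemma contour_shift_rect:
  fixes R \<tau> L B :: real
  assumes R: "0 \<le> R" and tau: "0 \<le> \<tau>" and L: "2 \<le> L" and B: "0 < B"
    and bound: "\<And>z. Im z = 0 \<or> Im z = 3 * pi / 2 \<or> 1 \<le> \<bar>Re z\<bar> \<and> \<bar>Im z\<bar> \<le> 5 \<Longrightarrow>
      norm (cosh z ^ k1 * z ^ k2 / sinhc z ^ (n + k1)) \<le> B / (1 + (Re z)\<^sup>2)"
  shows "norm (integral {-L..L} (\<lambda>x. heat_integrand R \<tau> n k1 k2 (of_real x))
      - 2 * pi * \<i> * residue (heat_integrand R \<tau> n k1 k2) (\<i> * pi))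
    \<le> B * pi * exp (- (3 * pi / 2) * \<tau>) + 10 * B / (1 + L\<^sup>2)"
proof -
  define f where "f = heat_integrand R \<tau> n k1 k2"
  define c where "c = 3 * pi / 2"
  define S where "S = {z. - pi < Im z \<and> Im z < 2 * pi}"
  have c: "pi < c" "c < 5" "c < 2 * pi" "0 < c" using pi_approx by (auto simp: c_def)
  define a1 a2 a3 a4 where "a1 = Complex (-L) 0" and "a2 = Complex L 0"
    and "a3 = Complex L c" and "a4 = Complex (-L) c"
  have S: "open S" "convex S"
    unfolding S_def
    by (auto intro!: open_Collect_conj open_halfspace_Im_gt open_halfspace_Im_lt
        simp: Collect_conj_eq intro: convex_Int convex_halfspace_Im_gt convex_halfspace_Im_lt)
  have holo: "f holomorphic_on S - {\<i> * pi}" unfolding f_def S_def by (rule heat_integrand_holomorphic)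
  have cont: "continuous_on (S - {\<i> * pi}) f" unfolding f_def S_def by (rule heat_integrand_continuous_on)
  have sub: "path_image (rectpath a1 a3) \<subseteq> S - {\<i> * pi}"
    using L c by (auto simp: path_image_rectpath a1_def a3_def S_def)
  have "contour_integral (rectpath a1 a3) f
      = 2 * pi * \<i> * (\<Sum>p\<in>{\<i> * pi}. winding_number (rectpath a1 a3) p * residue f p)"
  proof (rule Residue_theorem[OF S(1) convex_connected[OF S(2)] _ holo _ _ sub])
    show "\<forall>z. z \<notin> S \<longrightarrow> winding_number (rectpath a1 a3) z = 0"
      using sub S by (auto intro!: winding_number_zero_outside[where s = S])
  qed auto
  moreover have "winding_number (rectpath a1 a3) (\<i> * pi) = 1"
    using L c by (intro winding_number_rectpath) (auto simp: a1_def a3_def in_box_complex_iff)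
  ultimately have res: "contour_integral (rectpath a1 a3) f = 2 * pi * \<i> * residue f (\<i> * pi)" by simp
  have rp: "rectpath a1 a3 = linepath a1 a2 +++ linepath a2 a3 +++ linepath a3 a4 +++ linepath a4 a1"
    by (simp add: rectpath_def Let_def a1_def a2_def a3_def a4_def)
  have seg: "closed_segment a1 a2 \<subseteq> S - {\<i> * pi}" "closed_segment a2 a3 \<subseteq> S - {\<i> * pi}"
    "closed_segment a3 a4 \<subseteq> S - {\<i> * pi}" "closed_segment a4 a1 \<subseteq> S - {\<i> * pi}"
    using sub unfolding rp by (auto simp: path_image_join)
  have ints: "f contour_integrable_on linepath a1 a2" "f contour_integrable_on linepath a2 a3"
    "f contour_integrable_on linepath a3 a4" "f contour_integrable_on linepath a4 a1"
    using seg by (auto intro!: contour_integrable_continuous_linepath continuous_on_subset[OF cont])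
  have sum: "contour_integral (rectpath a1 a3) f = contour_integral (linepath a1 a2) f
      + contour_integral (linepath a2 a3) f + contour_integral (linepath a3 a4) f
      + contour_integral (linepath a4 a1) f"
    unfolding rp using ints
    by (simp add: contour_integrable_joinI add.assoc)
  have bottom: "contour_integral (linepath a1 a2) f = integral {-L..L} (\<lambda>x. f (of_real x))"
    using L by (subst contour_integral_linepath_Reals_eq)
      (auto simp: a1_def a2_def complex_is_Real_iff)
  \<comment> \<open>Here L sinh (2 L) \<ge> 2 L^2 \<ge> 8, while Im z sin (2 Im z) > -5; this fixes
    the requirement \<open>2 \<le> L\<close>.\<close>
  have vert: "norm (f z) \<le> B / (1 + L\<^sup>2)" if "\<bar>Re z\<bar> = L" "0 \<le> Im z" "Im z \<le> c" for z
  proof -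
    have "2 * L \<le> sinh (2 * L)" using real_le_x_sinh[of "2 * L"] L by (simp add: sinh_def exp_minus)
    then have "L * (2 * L) \<le> L * sinh (2 * L)" using L by (intro mult_left_mono) auto
    moreover have "2 * (2 * 2) \<le> L * (2 * L)" using L by (intro mult_mono) auto
    moreover have "Re z * sinh (2 * Re z) = L * sinh (2 * L)"
      using that(1) by (cases "0 \<le> Re z") (auto simp: abs_if split: if_splits)
    moreover have "Im z * sin (2 * Im z) \<ge> Im z * (- 1)"
      using that by (intro mult_left_mono) auto
    ultimately have "0 \<le> Re z * sinh (2 * Re z) + Im z * sin (2 * Im z)"
      using that(3) c by linarith
    from norm_heat_integrand_le[OF R this]
    have "norm (f z) \<le> exp (- \<tau> * Im z) * norm (cosh z ^ k1 * z ^ k2 / sinhc z ^ (n + k1))"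
      by (simp add: f_def)
    also have "\<dots> \<le> 1 * (B / (1 + (Re z)\<^sup>2))"
      using that tau c L by (intro mult_mono bound) auto
    also have "(Re z)\<^sup>2 = L\<^sup>2" using that(1) by (metis power2_abs)
    finally show ?thesis by simp
  qed
  have BL: "0 \<le> B / (1 + L\<^sup>2)" using B by (simp add: add_pos_nonneg)
  have v1: "norm (contour_integral (linepath a2 a3) f) \<le> B / (1 + L\<^sup>2) * norm (a3 - a2)"
    by (rule contour_integral_bound_linepath[OF ints(2) BL], rule vert)
      (use L c in \<open>auto simp: a2_def a3_def closed_segment_same_Re closed_segment_eq_real_ivl\<close>)
  have v2: "norm (contour_integral (linepath a4 a1) f) \<le> B / (1 + L\<^sup>2) * norm (a1 - a4)"
    by (rule contour_integral_bound_linepath[OF ints(4) BL], rule vert)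
      (use L c in \<open>auto simp: a1_def a4_def closed_segment_same_Re closed_segment_eq_real_ivl\<close>)
  have nrm: "norm (a3 - a2) = c" "norm (a1 - a4) = c"
    using c by (auto simp: a1_def a2_def a3_def a4_def cmod_def)
  \<comment> \<open>The top side is traversed from left to right and translated to the real axis;
    the reversal changes only the sign.\<close>
  have "norm (contour_integral (linepath a3 a4) f) \<le> B * pi * exp (- c * \<tau>)"
  proof -
    let ?g = "\<lambda>x. f (Complex x c)"
    have "(f has_contour_integral contour_integral (linepath a4 a3) f) (linepath a4 a3)"
      using seg(3) by (intro has_contour_integral_integral contour_integrable_continuous_linepath
          continuous_on_subset[OF cont]) (simp add: closed_segment_commute)
    moreover have "linepath a4 a3 = (+) (\<i> * c) \<circ> linepath (of_real (- L)) (of_real L)"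
      by (simp add: fun_eq_iff a4_def a3_def linepath_def complex_eq_iff left_diff_distrib)
    ultimately have "((\<lambda>z. f (z + \<i> * c)) has_contour_integral contour_integral (linepath a4 a3) f)
        (linepath (of_real (- L)) (of_real L))"
      by (simp only: has_contour_integral_translate)
    then have gi: "(?g has_integral contour_integral (linepath a4 a3) f) {-L..L}"
      using L by (subst (asm) has_contour_integral_linepath_Reals_iff)
        (auto simp: Complex_eq)
    have "norm (?g x) \<le> B * exp (- c * \<tau>) * (1 / (1 + x\<^sup>2))" for x
    proof -
      let ?z = "Complex x c"
      have "sin (2 * c) = 0" unfolding c_def using sin_npi[of 3] by simp
      moreover have "0 \<le> x * sinh (2 * x)" by (cases "0 \<le> x") (auto simp: mult_nonpos_nonpos)
      ultimately have "norm (f ?z) \<le> exp (- \<tau> * Im ?z) * norm (cosh ?z ^ k1 * ?z ^ k2 / sinhc ?z ^ (n + k1))"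
        unfolding f_def by (intro norm_heat_integrand_le[OF R]) simp
      also have "\<dots> \<le> exp (- \<tau> * Im ?z) * (B / (1 + (Re ?z)\<^sup>2))"
        by (intro mult_left_mono bound) (auto simp: c_def)
      finally show ?thesis by (simp add: mult_ac)
    qed
    then have "norm (integral {-L..L} ?g) \<le> integral {-L..L} (\<lambda>x. B * exp (- c * \<tau>) * (1 / (1 + x\<^sup>2)))"
      using gi integral_inverse_1_plus_square_le(1)[of L] L
      by (intro integral_norm_bound_integral integrable_on_mult_right) (auto simp: has_integral_integrable)
    also have "\<dots> \<le> B * exp (- c * \<tau>) * pi"
      using B L by (simp only: integral_mult_right, intro mult_left_mono integral_inverse_1_plus_square_le) auto
    finally have "norm (contour_integral (linepath a4 a3) f) \<le> B * exp (- c * \<tau>) * pi"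
      using integral_unique[OF gi] by simp
    then show ?thesis
      using contour_integral_reversepath[of "linepath a4 a3" f] by (simp add: mult_ac)
  qed
  moreover have "B / (1 + L\<^sup>2) * c \<le> B / (1 + L\<^sup>2) * 5" using BL c by (intro mult_left_mono) auto
  moreover have "integral {-L..L} (\<lambda>x. f (of_real x)) - 2 * pi * \<i> * residue f (\<i> * pi)
    = - (contour_integral (linepath a2 a3) f + contour_integral (linepath a3 a4) f
      + contour_integral (linepath a4 a1) f)"
    using res sum bottom by (simp add: algebra_simps)
  ultimately show ?thesis
    using v1 v2 nrm norm_triangle_ineq[of "contour_integral (linepath a2 a3) f + contour_integral (linepath a3 a4) f" "contour_integral (linepath a4 a1) f"]
      norm_triangle_ineq[of "contour_integral (linepath a2 a3) f" "contour_integral (linepath a3 a4) f"]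
    unfolding f_def[symmetric] c_def[symmetric] by (simp only: norm_minus_cancel)
qed

text \<open>Limit of the rectangles along integer L: the vertical sides vanish, and the integrand,
  being absolutely integrable, is its own dominating function.\<close>

lemma contour_shift:
  fixes R \<tau> B :: real
  assumes R: "0 \<le> R" and tau: "0 \<le> \<tau>" and B: "0 < B"
    and bound: "\<And>z. Im z = 0 \<or> Im z = 3 * pi / 2 \<or> 1 \<le> \<bar>Re z\<bar> \<and> \<bar>Im z\<bar> \<le> 5 \<Longrightarrow>
      norm (cosh z ^ k1 * z ^ k2 / sinhc z ^ (n + k1)) \<le> B / (1 + (Re z)\<^sup>2)"
  shows "norm ((LBINT l. heat_integrand R \<tau> n k1 k2 (of_real l)) - 2 * pi * \<i> * residue (heat_integrand R \<tau> n k1 k2) (\<i> * pi))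
    \<le> B * pi * exp (- (3 * pi / 2) * \<tau>)"
proof -
  define F where "F = (\<lambda>l::real. heat_integrand R \<tau> n k1 k2 (of_real l))"
  have Fle: "norm (F l) \<le> B / (1 + l\<^sup>2)" for l
  proof -
    let ?z = "complex_of_real l"
    have "0 \<le> l * sinh (2 * l)" by (cases "0 \<le> l") (auto simp: mult_nonpos_nonpos)
    then have "norm (F l) \<le> exp (- \<tau> * Im ?z) * norm (cosh ?z ^ k1 * ?z ^ k2 / sinhc ?z ^ (n + k1))"
      unfolding F_def by (intro norm_heat_integrand_le[OF R]) simp
    also have "\<dots> \<le> B / (1 + l\<^sup>2)" using bound[of ?z] by simp
    finally show ?thesis .
  qed
  have "continuous_on UNIV F"
    unfolding F_def
    by (rule continuous_on_compose2[OF heat_integrand_continuous_on]) (auto intro!: continuous_intros simp: complex_eq_iff)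
  then have meas [measurable]: "F \<in> borel_measurable borel" by (rule borel_measurable_continuous_onI)
  have int: "integrable lborel F"
    using Fle by (intro Bochner_Integration.integrable_bound[OF integrable_inverse_1_plus_square_UNIV[of B]])
      (auto intro!: AE_I2 order_trans[OF Fle] simp: abs_of_pos[OF B])
  have seq: "integral {- real m..real m} F = (LBINT l. indicator {- real m..real m} l *\<^sub>R F l)" for m
    using set_borel_integral_eq_integral(2)[of "{- real m..real m}" F] int
    by (simp add: set_lebesgue_integral_def set_integrable_def integrable_mult_indicator)
  have lim: "(\<lambda>m. integral {- real m..real m} F) \<longlonglongrightarrow> (LBINT l. F l)"
    unfolding seq
  proof (rule integral_dominated_convergence[where w = "\<lambda>l. norm (F l)"])
    show "AE l in lborel. (\<lambda>m. indicator {- real m..real m} l *\<^sub>R F l) \<longlonglongrightarrow> F l"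
    proof (rule AE_I2)
      fix l :: real
      obtain m0 :: nat where "\<bar>l\<bar> \<le> real m0" using real_arch_simple by blast
      then have "\<forall>\<^sub>F m in sequentially. indicator {- real m..real m} l *\<^sub>R F l = F l"
        by (intro eventually_sequentiallyI[of m0]) (auto simp: indicator_def)
      then show "(\<lambda>m. indicator {- real m..real m} l *\<^sub>R F l) \<longlonglongrightarrow> F l"
        by (rule tendsto_eventually)
    qed
  qed (use int in \<open>auto simp: indicator_def\<close>)
  let ?r = "2 * pi * \<i> * residue (heat_integrand R \<tau> n k1 k2) (\<i> * pi)"
  have "(\<lambda>m. 10 * B / (1 + (real m)\<^sup>2)) \<longlonglongrightarrow> 0" by real_asymp
  then have "(\<lambda>m. B * pi * exp (- (3 * pi / 2) * \<tau>) + 10 * B / (1 + (real m)\<^sup>2))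
      \<longlonglongrightarrow> B * pi * exp (- (3 * pi / 2) * \<tau>) + 0"
    by (intro tendsto_intros)
  moreover have "(\<lambda>m. norm (integral {- real m..real m} F - ?r)) \<longlonglongrightarrow> norm ((LBINT l. F l) - ?r)"
    by (intro tendsto_intros lim)
  moreover have "\<exists>N. \<forall>m\<ge>N. norm (integral {- real m..real m} F - ?r)
      \<le> B * pi * exp (- (3 * pi / 2) * \<tau>) + 10 * B / (1 + (real m)\<^sup>2)"
    unfolding F_def using contour_shift_rect[OF R tau _ B bound] by (intro exI[of _ 2]) auto
  ultimately have "norm ((LBINT l. F l) - ?r) \<le> B * pi * exp (- (3 * pi / 2) * \<tau>) + 0"
    using LIMSEQ_le by blast
  then show ?thesis by (simp add: F_def)
qed

section \<open>The residue at \<open>i\<pi>\<close>\<close>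

text \<open>This is I_\<nu> (2 sqrt q) divided by q^(\<nu>/2). The normalisation is entire in q,
  which avoids a branch of the square root and allows q = 0.\<close>

definition bessel_series :: "nat \<Rightarrow> 'a::{real_normed_field,banach} \<Rightarrow> 'a" where
  "bessel_series \<nu> q = (\<Sum>k. q ^ k / (fact k * fact (k + \<nu>)))"

lemma summable_bessel_series: "summable (\<lambda>k. q ^ k / (fact k * fact (k + \<nu>)))"
  for q :: "'a::{real_normed_field,banach}"
proof (rule summable_comparison_test[OF exI summable_norm_exp[of q]], intro allI impI)
  fix k :: nat
  have ge1: "1 \<le> (fact (k + \<nu>) :: real)" by (simp add: fact_ge_1)
  show "norm (q ^ k / (fact k * fact (k + \<nu>))) \<le> norm (q ^ k /\<^sub>R fact k)"
    using mult_left_mono[OF ge1, of "norm q ^ k"] by (simp add: norm_divide norm_mult norm_power divide_simps)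
qed

lemma higher_deriv_exp_mult: "(deriv ^^ m) (\<lambda>w. exp (a * w)) = (\<lambda>w. a ^ m * exp (a * w :: complex))"
proof (induction m)
  case (Suc m)
  have "deriv (\<lambda>w. a ^ m * exp (a * w)) w = a ^ Suc m * exp (a * w)" for w
    by (rule DERIV_imp_deriv) (auto intro!: derivative_eq_intros)
  then show ?case using Suc by auto
qed simp

text \<open>Expand exp (b / w). The k-th term is Cauchy's formula for the derivative of order k +
  \<nu> of exp (a w) at 0, and the series of exp (|b| / r) is a majorant on the circle, so summation
  and integration commute.\<close>

lemma bessel_contour_integral:
  fixes a b :: complex
  assumes r: "0 < r"
  shows "((\<lambda>w. exp (a * w + b / w) / w ^ Suc \<nu>) has_contour_integral
    2 * pi * \<i> * (a ^ \<nu> * bessel_series \<nu> (a * b))) (circlepath 0 r)"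
proof -
  let ?f = "\<lambda>k w. b ^ k / fact k * (exp (a * w) / w ^ Suc (k + \<nu>))"
  let ?g = "\<lambda>w. exp (a * w + b / w) / w ^ Suc \<nu>"
  have summand: "(?f k has_contour_integral
      2 * pi * \<i> * a ^ \<nu> * ((a * b) ^ k / (fact k * fact (k + \<nu>)))) (circlepath 0 r)" for k
  proof -
    have "((\<lambda>w. exp (a * w) / (w - 0) ^ Suc (k + \<nu>)) has_contour_integral
        2 * pi * \<i> / fact (k + \<nu>) * (deriv ^^ (k + \<nu>)) (\<lambda>w. exp (a * w)) 0) (circlepath 0 r)"
      using r by (intro Cauchy_has_contour_integral_higher_derivative_circlepath)
        (auto intro!: continuous_intros holomorphic_intros)
    from has_contour_integral_lmul[OF this, of "b ^ k / fact k"] show ?thesis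
      unfolding higher_deriv_exp_mult
      by (simp add: power_add power_mult_distrib mult_ac del: power_Suc)
  qed
  have psum: "((\<lambda>w. \<Sum>k<m. ?f k w) has_contour_integral
      (\<Sum>k<m. 2 * pi * \<i> * a ^ \<nu> * ((a * b) ^ k / (fact k * fact (k + \<nu>))))) (circlepath 0 r)" for m
    by (intro has_contour_integral_sum summand) auto
  have ulim: "uniform_limit (sphere 0 r) (\<lambda>m w. \<Sum>k<m. ?f k w) (\<lambda>w. \<Sum>k. ?f k w) sequentially"
  proof (rule Weierstrass_m_test)
    fix k w assume w: "w \<in> sphere (0::complex) r"
    have "Re (a * w) \<le> norm a * r" using w complex_Re_le_cmod[of "a * w"] by (simp add: norm_mult)
    then have "norm (?f k w) \<le> norm b ^ k / fact k * (exp (norm a * r) / r ^ Suc (k + \<nu>))"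
      using w r by (auto simp: norm_mult norm_divide norm_power intro!: mult_left_mono divide_right_mono)
    also have "\<dots> = exp (norm a * r) / r ^ Suc \<nu> * ((norm b / r) ^ k /\<^sub>R fact k)"
      by (simp add: power_add power_divide field_simps)
    finally show "norm (?f k w) \<le> exp (norm a * r) / r ^ Suc \<nu> * ((norm b / r) ^ k /\<^sub>R fact k)" .
  next
    show "summable (\<lambda>k. exp (norm a * r) / r ^ Suc \<nu> * ((norm b / r) ^ k /\<^sub>R fact k))"
      by (intro summable_mult summable_exp_generic)
  qed
  have eq: "(\<Sum>k. ?f k w) = ?g w" if "w \<in> sphere 0 r" for w
  proof -
    have w: "w \<noteq> 0" using that r by auto
    have "(\<lambda>k. exp (a * w) / w ^ Suc \<nu> * ((b / w) ^ k /\<^sub>R fact k)) sums (exp (a * w) / w ^ Suc \<nu> * exp (b / w))"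
      by (intro sums_mult exp_converges)
    moreover have "exp (a * w) / w ^ Suc \<nu> * ((b / w) ^ k /\<^sub>R fact k) = ?f k w" for k
      using w by (simp add: power_add power_divide scaleR_conv_of_real field_simps)
    ultimately show ?thesis by (simp add: sums_iff exp_add)
  qed
  have ul: "uniform_limit (sphere 0 r) (\<lambda>m w. \<Sum>k<m. ?f k w) ?g sequentially"
    by (rule iffD1[OF uniform_limit_cong'[OF refl eq] ulim])
  have integ: "\<forall>\<^sub>F m in sequentially. (\<lambda>w. \<Sum>k<m. ?f k w) contour_integrable_on circlepath 0 r"
    unfolding contour_integrable_on_def using psum by (intro always_eventually allI exI)
  note lim = contour_integral_uniform_limit_circlepath[OF integ ul _ r]
  have "(\<lambda>m. \<Sum>k<m. 2 * pi * \<i> * a ^ \<nu> * ((a * b) ^ k / (fact k * fact (k + \<nu>))))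
      \<longlonglongrightarrow> contour_integral (circlepath 0 r) ?g"
    using lim(2) psum[THEN contour_integral_unique] by simp
  moreover have "(\<lambda>m. \<Sum>k<m. 2 * pi * \<i> * a ^ \<nu> * ((a * b) ^ k / (fact k * fact (k + \<nu>))))
      \<longlonglongrightarrow> 2 * pi * \<i> * a ^ \<nu> * bessel_series \<nu> (a * b)"
    unfolding bessel_series_def
    using sums_mult[OF summable_sums[OF summable_bessel_series[of "a * b" \<nu>]]] unfolding sums_def by blast
  ultimately have "contour_integral (circlepath 0 r) ?g = 2 * pi * \<i> * a ^ \<nu> * bessel_series \<nu> (a * b)"
    by (rule LIMSEQ_unique)
  then show ?thesis
    using has_contour_integral_integral[OF lim(1)] by (simp add: mult.assoc)
qed

text \<open>The difference quotient at 0, completed by the derivative, is holomorphic, hence bounded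
  on the compact unit disc.\<close>

lemma holomorphic_lipschitz_at_0:
  assumes "f holomorphic_on ball 0 2"
  obtains K where "0 < K" "\<And>w. norm w \<le> 1 \<Longrightarrow> norm (f w - f 0) \<le> K * norm w"
proof -
  define g where "g = (\<lambda>z. if z = 0 then deriv f 0 else (f z - f 0) / (z - 0))"
  have "g holomorphic_on ball 0 2"
    unfolding g_def by (rule pole_lemma_open[OF assms]) simp
  then have "continuous_on (cball 0 1) g"
    by (intro holomorphic_on_imp_continuous_on) (auto elim!: holomorphic_on_subset)
  then have "bounded (g ` cball 0 1)" by (intro compact_imp_bounded compact_continuous_image) auto
  then obtain K where K: "0 < K" "\<And>w. norm w \<le> 1 \<Longrightarrow> norm (g w) \<le> K"
    by (auto simp: bounded_pos)
  show ?thesis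
  proof (rule that[OF K(1)])
    fix w :: complex assume "norm w \<le> 1"
    have "f w - f 0 = g w * w" by (simp add: g_def)
    then show "norm (f w - f 0) \<le> K * norm w"
      using K(2)[OF \<open>norm w \<le> 1\<close>] by (simp add: norm_mult mult_right_mono)
  qed
qed

section \<open>Factorisation of the integrand at i pi\<close>

lemma sinhc_nonzero_ball: "norm w < 2 \<Longrightarrow> sinhc w \<noteq> 0"
proof (rule sinhc_nonzero)
  assume w: "norm w < 2"
  have "\<bar>Im w\<bar> < 2" using w abs_Im_le_cmod[of w] by linarith
  then show "- pi < Im w" "Im w < 2 * pi" using pi_gt3 by auto
  show "w \<noteq> \<i> * pi" using w pi_gt3 by (auto simp: norm_mult)
qed

text \<open>What remains of -z coth z at z = i pi + w after its polar part -i pi / w is removed;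
  regular because \<open>sinhc w - cosh w\<close> vanishes at 0.\<close>

definition pole_exponent :: "complex \<Rightarrow> complex" where
  "pole_exponent w = (\<i> * pi * ((sinhc w - cosh w) / w) - cosh w) / sinhc w"

text \<open>The amplitude at i pi + w multiplied by \<open>w ^ (n + k1)\<close>. Its value at 0 is
  the constant in front of the Bessel function.\<close>

definition pole_amplitude :: "nat \<Rightarrow> nat \<Rightarrow> nat \<Rightarrow> complex \<Rightarrow> complex" where
  "pole_amplitude n k1 k2 w = (- cosh w) ^ k1 * (\<i> * pi + w) ^ (k2 + (n + k1)) / (- sinhc w) ^ (n + k1)"

text \<open>An exact identity from cosh (i pi + w) = -cosh w and sinh (i pi + w) = -sinh w. Only the
  last factor is singular, and its contour integral is known.\<close>

lemma heat_integrand_near_pole: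
  assumes w: "w \<noteq> 0" "norm w < 2"
  shows "heat_integrand R \<tau> n k1 k2 (\<i> * pi + w) = exp (- pi * \<tau>) *
    (exp (R * pole_exponent w) * pole_amplitude n k1 k2 w *
      (exp (\<i> * \<tau> * w + (- \<i> * pi * R) / w) / w ^ (n + k1)))"
proof -
  have nz: "sinhc w \<noteq> 0" by (rule sinhc_nonzero_ball[OF w(2)])
  have p: "\<i> * pi + w \<noteq> 0"
  proof
    assume "\<i> * pi + w = 0"
    then have "w = - (\<i> * pi)" by (simp add: add_eq_0_iff)
    then show False using w pi_gt3 by (simp add: norm_mult)
  qed
  have "cosh (\<i> * pi) = - 1" "sinh (\<i> * pi) = 0"
    by (simp_all add: complex_eq_iff complex_sinh_cosh_parts)
  then have ch: "cosh (\<i> * pi + w) = - cosh w" and sh: "sinh (\<i> * pi + w) = - sinh w"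
    by (simp_all add: cosh_add sinh_add)
  have shc: "sinhc (\<i> * pi + w) = - (w * sinhc w) / (\<i> * pi + w)"
  proof -
    have "(\<i> * pi + w) * sinhc (\<i> * pi + w) = - (w * sinhc w)"
      using sh unfolding sinh_eq_mult_sinhc .
    then show ?thesis using p by (simp only: nonzero_eq_divide_eq mult.commute not_False_eq_True)
  qed
  have expo: "\<i> * \<tau> * (\<i> * pi + w) - R * (cosh (\<i> * pi + w) / sinhc (\<i> * pi + w))
      = of_real (- pi * \<tau>) + R * pole_exponent w + (\<i> * \<tau> * w + (- \<i> * pi * R) / w)"
    using nz w p unfolding ch shc pole_exponent_def by (simp add: field_simps)
  have amp: "cosh (\<i> * pi + w) ^ k1 * (\<i> * pi + w) ^ k2 / sinhc (\<i> * pi + w) ^ (n + k1)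
      = pole_amplitude n k1 k2 w / w ^ (n + k1)"
  proof -
    have "sinhc (\<i> * pi + w) = w * (- sinhc w) / (\<i> * pi + w)" by (simp add: shc)
    then show ?thesis using p w nz
      unfolding ch pole_amplitude_def by (simp only: power_divide power_mult_distrib power_add) 
        (simp add: field_simps)
  qed
  show ?thesis unfolding heat_integrand_def expo amp exp_add exp_of_real by simp
qed

lemma pole_factor_estimate:
  obtains K \<rho> where "0 < K" "0 < \<rho>"
    "\<And>R w. 0 \<le> R \<Longrightarrow> R \<le> \<rho> \<Longrightarrow> w \<noteq> 0 \<Longrightarrow> norm w \<le> 1 \<Longrightarrow>
      norm (exp (of_real R * pole_exponent w) * pole_amplitude n k1 k2 w - pole_amplitude n k1 k2 0)
        \<le> K * (norm w + R)"
proof -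
  have nz: "sinhc w \<noteq> 0" if "w \<in> ball 0 2" for w using that sinhc_nonzero_ball by simp
  obtain K1 where K1: "0 < K1" "\<And>w. norm w \<le> 1 \<Longrightarrow> norm ((sinhc w - cosh w) - (sinhc 0 - cosh 0)) \<le> K1 * norm w"
    by (rule holomorphic_lipschitz_at_0[of "\<lambda>w. sinhc w - cosh w"])
      (auto intro!: holomorphic_intros holomorphic_sinh_cosh)
  obtain K2 where K2: "0 < K2" "\<And>w. norm w \<le> 1 \<Longrightarrow> norm (cosh w - cosh (0::complex)) \<le> K2 * norm w"
    using holomorphic_lipschitz_at_0[of cosh] holomorphic_sinh_cosh by metis
  obtain K3 where K3: "0 < K3" "\<And>w. norm w \<le> 1 \<Longrightarrow> norm (1 / sinhc w - 1 / sinhc 0) \<le> K3 * norm w"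
    by (rule holomorphic_lipschitz_at_0[of "\<lambda>w. 1 / sinhc w"]) (use nz in \<open>auto intro!: holomorphic_intros\<close>)
  obtain K4 where K4: "0 < K4" "\<And>w. norm w \<le> 1 \<Longrightarrow>
      norm (pole_amplitude n k1 k2 w - pole_amplitude n k1 k2 0) \<le> K4 * norm w"
  proof (rule holomorphic_lipschitz_at_0[of "pole_amplitude n k1 k2"])
    show "pole_amplitude n k1 k2 holomorphic_on ball 0 2" unfolding pole_amplitude_def
      by (intro holomorphic_intros holomorphic_on_divide holomorphic_sinh_cosh) (use nz in auto)
  qed auto
  obtain K5 where K5: "0 < K5" "\<And>w::complex. norm w \<le> 1 \<Longrightarrow> norm (exp w - exp 0) \<le> K5 * norm w"
    by (rule holomorphic_lipschitz_at_0[of exp]) (auto intro!: holomorphic_intros)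
  define Kh where "Kh = (pi * K1 + (1 + K2)) * (1 + K3)"
  have Kh: "0 < Kh" using K1 K2 K3 pi_gt_zero by (auto simp: Kh_def intro!: mult_pos_pos add_pos_pos)
  define H0 where "H0 = norm (pole_amplitude n k1 k2 0)"
  have hb: "norm (pole_exponent w) \<le> Kh" if w: "w \<noteq> 0" "norm w \<le> 1" for w
  proof -
    have "norm ((sinhc w - cosh w) / w) \<le> K1" using K1(2)[OF w(2)] w(1) by (simp add: norm_divide field_simps)
    then have 1: "norm (\<i> * pi * ((sinhc w - cosh w) / w)) \<le> pi * K1"
      unfolding norm_mult by simp
    have "K2 * norm w \<le> K2" "K3 * norm w \<le> K3" using w K2 K3 by (auto simp: mult_left_le)
    then have 2: "norm (cosh w) \<le> 1 + K2" and 3: "norm (1 / sinhc w) \<le> 1 + K3"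
      using K2(2)[OF w(2)] K3(2)[OF w(2)] norm_triangle_ineq2[of "cosh w" 1] norm_triangle_ineq2[of "1 / sinhc w" 1]
      by auto
    have "norm (pole_exponent w) = norm (\<i> * pi * ((sinhc w - cosh w) / w) - cosh w) * norm (1 / sinhc w)"
      by (simp add: pole_exponent_def norm_divide)
    also have "\<dots> \<le> Kh" unfolding Kh_def
      using 1 2 3 K1(1) K2(1) by (intro mult_mono order_trans[OF norm_triangle_ineq4] add_mono) auto
    finally show ?thesis .
  qed
  \<comment> \<open>Keeps \<open>R * pole_exponent w\<close> in the unit disc, where the Lipschitz
    bound for exp applies.\<close>
  define \<rho> where "\<rho> = 1 / Kh"
  define K where "K = (1 + K5) * K4 + K5 * Kh * H0"
  show ?thesis
  proof (rule that[of K \<rho>])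
    show "0 < K" "0 < \<rho>" using K4 K5 Kh by (auto simp: K_def \<rho>_def H0_def intro!: add_pos_nonneg mult_pos_pos)
    fix R :: real and w :: complex
    assume R: "0 \<le> R" "R \<le> \<rho>" and w: "w \<noteq> 0" "norm w \<le> 1"
    let ?E = "exp (of_real R * pole_exponent w)" and ?H = "pole_amplitude n k1 k2"
    have hR: "norm (of_real R * pole_exponent w) \<le> R * Kh"
      using R hb[OF w] by (simp add: norm_mult mult_left_mono)
    moreover have "R * Kh \<le> 1" using R Kh by (simp add: \<rho>_def field_simps)
    ultimately have le1: "norm (of_real R * pole_exponent w) \<le> 1" by linarith
    have E: "norm (?E - 1) \<le> K5 * (R * Kh)"
      using order_trans[OF K5(2)[OF le1] mult_left_mono[OF hR]] K5(1) by simp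
    have "norm (?E - 1) \<le> K5 * 1"
      using order_trans[OF K5(2)[OF le1] mult_left_mono[OF le1]] K5(1) by simp
    then have E1: "norm ?E \<le> 1 + K5" using norm_triangle_ineq2[of ?E 1] by simp
    \<comment> \<open>The first summand contributes the error in |w|, the second the error in
      R.\<close>
    have "?E * ?H w - ?H 0 = ?E * (?H w - ?H 0) + (?E - 1) * ?H 0" by (simp add: algebra_simps)
    then have "norm (?E * ?H w - ?H 0) \<le> norm ?E * norm (?H w - ?H 0) + norm (?E - 1) * H0"
      by (metis H0_def norm_mult norm_triangle_ineq)
    also have "\<dots> \<le> (1 + K5) * (K4 * norm w) + K5 * (R * Kh) * H0"
      using E E1 K4(2)[OF w(2)] K5 by (intro add_mono mult_mono mult_right_mono) (auto simp: H0_def)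
    also have "\<dots> \<le> K * (norm w + R)"
    proof -
      have "0 \<le> (1 + K5) * K4 * R" "0 \<le> K5 * Kh * H0 * norm w"
        using K4 K5 Kh R by (auto simp: H0_def)
      then show ?thesis by (simp add: K_def algebra_simps)
    qed
    finally show "norm (?E * ?H w - ?H 0) \<le> K * (norm w + R)" .
  qed
qed

text \<open>On the circle of radius 1/\<tau> the singular factor is at most exp (1 + Q)
  \<tau>^(\<nu> + 1), and the regular factor deviates from its value at the pole by a multiple of
  1/\<tau> + R \<le> (1 + Q)/\<tau>.\<close>

lemma residue_estimate:
  fixes Q :: real
  assumes N: "n + k1 = Suc \<nu>" and Q: "0 \<le> Q"
  obtains K T where "0 < K" "1 < T"
    "\<And>R \<tau>. 0 \<le> R \<Longrightarrow> T \<le> \<tau> \<Longrightarrow> pi * R * \<tau> \<le> Q \<Longrightarrow>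
      norm (2 * pi * \<i> * residue (heat_integrand R \<tau> n k1 k2) (\<i> * pi)
        - exp (- pi * \<tau>) * (pole_amplitude n k1 k2 0 * (2 * pi * \<i> * ((\<i> * \<tau>) ^ \<nu> * bessel_series \<nu> (of_real (pi * R * \<tau>))))))
      \<le> K * exp (- pi * \<tau>) * \<tau> ^ \<nu> / \<tau>"
proof -
  obtain K0 \<rho> where K0: "0 < K0" and \<rho>: "0 < \<rho>" and est:
    "\<And>R w. 0 \<le> R \<Longrightarrow> R \<le> \<rho> \<Longrightarrow> w \<noteq> 0 \<Longrightarrow> norm w \<le> 1 \<Longrightarrow>
      norm (exp (of_real R * pole_exponent w) * pole_amplitude n k1 k2 w - pole_amplitude n k1 k2 0)
        \<le> K0 * (norm w + R)"
    using pole_factor_estimate[of n k1 k2] by metis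
  \<comment> \<open>The 2 makes the radius at most 1/2; the other term forces R \<le> Q/\<tau> \<le>
    \<rho>.\<close>
  define T where "T = 2 + Q / \<rho>"
  define K where "K = K0 * (1 + Q) * exp (1 + Q) * (2 * pi)"
  show ?thesis
  proof (rule that[of K T])
    show "0 < K" "1 < T" using K0 \<rho> Q by (auto simp: K_def T_def intro!: mult_pos_pos add_pos_nonneg)
    fix R \<tau> :: real
    assume R: "0 \<le> R" and \<tau>: "T \<le> \<tau>" and Q': "pi * R * \<tau> \<le> Q"
    have "0 \<le> Q / \<rho>" using Q \<rho> by simp
    then have tau: "2 \<le> \<tau>" "Q / \<rho> \<le> \<tau>" using \<tau> by (auto simp: T_def)
    have "R * \<tau> * 1 \<le> R * \<tau> * pi" using R tau pi_gt3 by (intro mult_left_mono) auto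
    then have RQ: "R * \<tau> \<le> Q" using Q' by (simp add: mult_ac)
    then have RQ': "R \<le> Q / \<tau>" using tau by (simp add: field_simps)
    moreover have "Q / \<tau> \<le> \<rho>" using tau \<rho> by (simp add: field_simps)
    ultimately have R\<rho>: "R \<le> \<rho>" by linarith
    define r where "r = 1 / \<tau>"
    have r: "0 < r" "r \<le> 1 / 2" using tau by (auto simp: r_def field_simps)
    let ?f = "heat_integrand R \<tau> n k1 k2"
    define g where "g = (\<lambda>w. exp (\<i> * \<tau> * w + (- \<i> * pi * R) / w) / w ^ Suc \<nu>)"
    define H0 where "H0 = pole_amplitude n k1 k2 0"
    let ?S = "{z. - pi < Im z \<and> Im z < 2 * pi}"
    have S: "open ?S"
      by (auto intro!: open_Collect_conj open_halfspace_Im_gt open_halfspace_Im_lt)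
    have "(?f has_contour_integral 2 * pi * \<i> * residue ?f (\<i> * pi)) (circlepath (\<i> * pi) r)"
    proof (rule base_residue[OF S _ r(1) heat_integrand_holomorphic])
      show "cball (\<i> * pi) r \<subseteq> ?S"
      proof
        fix z assume "z \<in> cball (\<i> * pi) r"
        then have "norm (z - \<i> * pi) \<le> 1 / 2" using r by (simp add: dist_norm norm_minus_commute)
        then have le: "\<bar>Im (z - \<i> * pi)\<bar> \<le> 1 / 2" using abs_Im_le_cmod order_trans by blast
        show "z \<in> ?S" using abs_le_D1[OF le] abs_le_D2[OF le] pi_gt3 by auto
      qed
    qed auto
    moreover have "circlepath (\<i> * pi) r = (+) (\<i> * pi) \<circ> circlepath 0 r"
      by (auto simp: circlepath fun_eq_iff)
    ultimately have f: "((\<lambda>w. ?f (\<i> * pi + w)) has_contour_integral 2 * pi * \<i> * residue ?f (\<i> * pi)) (circlepath 0 r)"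
      by (simp add: has_contour_integral_translate add.commute)
    have ab: "\<i> * complex_of_real \<tau> * (- \<i> * pi * R) = of_real (pi * R * \<tau>)" by (simp add: complex_eq_iff)
    have g: "((\<lambda>w. exp (- pi * \<tau>) * (H0 * g w)) has_contour_integral
      exp (- pi * \<tau>) * (H0 * (2 * pi * \<i> * ((\<i> * \<tau>) ^ \<nu> * bessel_series \<nu> (of_real (pi * R * \<tau>)))))) (circlepath 0 r)"
      unfolding g_def ab[symmetric]
      by (intro has_contour_integral_lmul bessel_contour_integral r)
    have bd: "norm (?f (\<i> * pi + w) - exp (- pi * \<tau>) * (H0 * g w))
        \<le> exp (- pi * \<tau>) * (K0 * ((1 + Q) / \<tau>) * (exp (1 + Q) * \<tau> ^ Suc \<nu>))" if "norm (w - 0) = r" for w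
    proof -
      have w: "w \<noteq> 0" "norm w \<le> 1" "norm w = r" "norm w < 2" using that r by auto
      let ?D = "exp (R * pole_exponent w) * pole_amplitude n k1 k2 w - H0"
      have eq: "?f (\<i> * pi + w) - exp (- pi * \<tau>) * (H0 * g w) = exp (- pi * \<tau>) * (?D * g w)"
        unfolding heat_integrand_near_pole[OF w(1,4)] N g_def by (simp only: right_diff_distrib left_diff_distrib mult.assoc)
      have Dle: "norm ?D \<le> K0 * ((1 + Q) / \<tau>)"
      proof -
        have "norm ?D \<le> K0 * (r + R)" using est[OF R R\<rho> w(1,2)] w(3) by (simp add: H0_def)
        also have "\<dots> \<le> K0 * ((1 + Q) / \<tau>)"
          using RQ' K0 by (intro mult_left_mono) (auto simp: r_def add_divide_distrib)
        finally show ?thesis .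
      qed
      have gle: "norm (g w) \<le> exp (1 + Q) * \<tau> ^ Suc \<nu>"
      proof -
        have "Re (\<i> * \<tau> * w + (- \<i> * pi * R) / w) \<le> norm (\<i> * \<tau> * w + (- \<i> * pi * R) / w)"
          by (rule complex_Re_le_cmod)
        also have "\<dots> \<le> norm (\<i> * \<tau> * w) + norm ((- \<i> * pi * R) / w)" by (rule norm_triangle_ineq)
        also have "\<dots> = 1 + pi * R * \<tau>"
          using tau R w(3) by (simp add: norm_mult norm_divide r_def)
        finally have "exp (Re (\<i> * \<tau> * w + (- \<i> * pi * R) / w)) \<le> exp (1 + Q)" using Q' by simp
        moreover have "norm (g w) = exp (Re (\<i> * \<tau> * w + (- \<i> * pi * R) / w)) * \<tau> ^ Suc \<nu>"
          unfolding g_def norm_divide norm_power w(3) norm_exp_eq_Re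
          by (simp only: r_def power_divide power_one) (simp add: field_simps)
        ultimately show ?thesis using tau by (simp add: mult_right_mono)
      qed
      have "norm (?D * g w) \<le> K0 * ((1 + Q) / \<tau>) * (exp (1 + Q) * \<tau> ^ Suc \<nu>)"
        unfolding norm_mult by (intro mult_mono Dle gle) (use K0 Q tau in auto)
      from mult_left_mono[OF this, of "exp (- pi * \<tau>)"] show ?thesis
        unfolding eq by (subst norm_mult) (simp only: norm_of_real abs_exp_cancel exp_ge_zero)
    qed
    have "norm (2 * pi * \<i> * residue ?f (\<i> * pi)
        - exp (- pi * \<tau>) * (H0 * (2 * pi * \<i> * ((\<i> * \<tau>) ^ \<nu> * bessel_series \<nu> (of_real (pi * R * \<tau>))))))
      \<le> exp (- pi * \<tau>) * (K0 * ((1 + Q) / \<tau>) * (exp (1 + Q) * \<tau> ^ Suc \<nu>)) * (2 * pi * r)"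
      by (rule has_contour_integral_bound_circlepath[OF has_contour_integral_diff[OF f g] _ r(1) bd])
        (use K0 Q tau in auto)
    \<comment> \<open>The circumference 2 pi / \<tau> lowers the exponent of \<tau> from \<nu> + 1
      to \<nu>; the surviving 1/\<tau> is the relative error.\<close>
    also have "\<dots> = K * exp (- pi * \<tau>) * \<tau> ^ \<nu> / \<tau>"
      using tau by (simp add: K_def r_def)
    finally show "norm (2 * pi * \<i> * residue ?f (\<i> * pi)
        - exp (- pi * \<tau>) * (pole_amplitude n k1 k2 0 * (2 * pi * \<i> * ((\<i> * \<tau>) ^ \<nu> * bessel_series \<nu> (of_real (pi * R * \<tau>))))))
      \<le> K * exp (- pi * \<tau>) * \<tau> ^ \<nu> / \<tau>" by (simp add: H0_def)
  qed
qed

section \<open>From the residue back to \<open>p1\<close>\<close>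

lemma cosh_sinh_of_real:
  "cosh (complex_of_real l) = of_real (cosh l)" "sinh (complex_of_real l) = of_real (sinh l)"
  by (simp_all add: complex_eq_iff complex_sinh_cosh_parts)

lemma p1_eq_heat_integrand:
  assumes n: "n \<ge> 1"
  shows "p1 n k1 k2 x t = (-1) ^ k1 * \<i> ^ k2 / of_real ((4 * pi) ^ n * (2 * pi)) *
    (LBINT l. heat_integrand (Rpar x) \<bar>t\<bar> n k1 k2 (of_real l))"
proof -
  let ?F = "\<lambda>l::real. heat_integrand (Rpar x) \<bar>t\<bar> n k1 k2 (of_real l)"
  let ?G = "\<lambda>l::real. exp (\<i> * complex_of_real (\<bar>t\<bar> * l)
                     - complex_of_real ((norm x)\<^sup>2 / 4 * \<bar>l\<bar> * (cosh \<bar>l\<bar> / sinh \<bar>l\<bar>)))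
               * complex_of_real (\<bar>l\<bar> ^ (n + k1) * cosh \<bar>l\<bar> ^ k1 / sinh \<bar>l\<bar> ^ (n + k1))
               * complex_of_real (l ^ k2)"
  have "continuous_on UNIV ?F"
    by (rule continuous_on_compose2[OF heat_integrand_continuous_on]) (auto intro!: continuous_intros simp: complex_eq_iff)
  then have meas [measurable]: "?F \<in> borel_measurable borel" by (rule borel_measurable_continuous_onI)
  \<comment> \<open>Division by zero makes the integrand of \<open>p1\<close> vanish at 0, where the extension need not.\<close>
  have eq: "?G l = indicator (- {0}) l *\<^sub>R ?F l" for l
  proof (cases "l = 0")
    case False
    have ch: "cosh \<bar>l\<bar> = cosh l" and q: "\<bar>l\<bar> / sinh \<bar>l\<bar> = l / sinh l"
      by (auto simp: abs_if)
    have "(norm x)\<^sup>2 / 4 * \<bar>l\<bar> * (cosh \<bar>l\<bar> / sinh \<bar>l\<bar>) = Rpar x * (cosh l * (\<bar>l\<bar> / sinh \<bar>l\<bar>))"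
      by (simp add: Rpar_def ch)
    then have 1: "(norm x)\<^sup>2 / 4 * \<bar>l\<bar> * (cosh \<bar>l\<bar> / sinh \<bar>l\<bar>) = Rpar x * (cosh l * (l / sinh l))"
      unfolding q .
    have "\<bar>l\<bar> ^ (n + k1) * cosh \<bar>l\<bar> ^ k1 / sinh \<bar>l\<bar> ^ (n + k1) = cosh l ^ k1 * (\<bar>l\<bar> / sinh \<bar>l\<bar>) ^ (n + k1)"
      by (simp add: ch power_divide)
    then have 2: "\<bar>l\<bar> ^ (n + k1) * cosh \<bar>l\<bar> ^ k1 / sinh \<bar>l\<bar> ^ (n + k1) = cosh l ^ k1 * (l / sinh l) ^ (n + k1)"
      unfolding q .
    show ?thesis
      unfolding 1 2 heat_integrand_def using False
      by (simp add: sinhc_def cosh_sinh_of_real power_divide algebra_simps)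
  qed (use n in simp)
  have "integral\<^sup>L lborel ?G = integral\<^sup>L lborel (\<lambda>l. indicator (- {0}) l *\<^sub>R ?F l)" unfolding eq ..
  also have "\<dots> = integral\<^sup>L lborel ?F"
  proof (rule integral_cong_AE)
    show "AE l in lborel. indicator (- {0}) l *\<^sub>R ?F l = ?F l"
      using AE_lborel_singleton[of 0] by eventually_elim simp
  qed auto
  finally show ?thesis unfolding p1_def by simp
qed

lemma bessel_series_of_real: "bessel_series \<nu> (of_real q) = (of_real (bessel_series \<nu> q) :: complex)"
  unfolding bessel_series_def by (subst suminf_of_real[OF summable_bessel_series]) simp

text \<open>At z = \<kappa> the argument z^2 / 4 is pi R |t|, the product a b of the contour
  integral.\<close>

lemma bessel_I_eq: "bessel_I \<nu> z = (z / 2) ^ \<nu> * bessel_series \<nu> (z\<^sup>2 / 4)"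
proof -
  have "z ^ (2 * k + \<nu>) / (2 ^ (2 * k + \<nu>) * fact k * Gamma (real (k + \<nu> + 1)))
      = (z / 2) ^ \<nu> * ((z\<^sup>2 / 4) ^ k / (fact k * fact (k + \<nu>)))" for k
  proof -
    have "Gamma (real (k + \<nu> + 1)) = fact (k + \<nu>)" using Gamma_fact[of "k + \<nu>", where ?'a = real] by (simp add: add_ac)
    moreover have "(2::real) ^ (2 * k) = 4 ^ k" by (simp add: power_mult)
    ultimately show ?thesis by (simp add: power_add power_mult[symmetric] power_divide mult_ac)
  qed
  then show ?thesis unfolding bessel_I_def bessel_series_def
    by (simp only: suminf_mult[OF summable_bessel_series])
qed

text \<open>The term k = 0 gives the lower bound, which later turns absolute errors into relative
  ones. The tail is at most exp q - 1 \<le> q exp q, which governs small \<kappa>.\<close>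

lemma bessel_series_bounds:
  fixes q :: real
  assumes "0 \<le> q"
  shows "1 / fact \<nu> \<le> bessel_series \<nu> q" "bessel_series \<nu> q \<le> 1 / fact \<nu> + q * exp q"
proof -
  let ?a = "\<lambda>k. q ^ k / (fact k * fact (k + \<nu>))" and ?b = "\<lambda>k. q ^ k /\<^sub>R fact k"
  have "(\<Sum>k. ?a (Suc k)) = bessel_series \<nu> q - ?a 0"
    unfolding bessel_series_def by (rule suminf_split_head[OF summable_bessel_series])
  then have split: "bessel_series \<nu> q = 1 / fact \<nu> + (\<Sum>k. ?a (Suc k))" by simp
  have sa: "summable (\<lambda>k. ?a (Suc k))" and sb: "summable (\<lambda>k. ?b (Suc k))"
    using summable_ignore_initial_segment[OF summable_bessel_series[of q \<nu>], of 1]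
      summable_ignore_initial_segment[OF summable_exp_generic[of q], of 1] by (simp_all only: Suc_eq_plus1)
  have "0 \<le> (\<Sum>k. ?a (Suc k))" by (rule suminf_nonneg[OF sa]) (use assms in simp)
  then show "1 / fact \<nu> \<le> bessel_series \<nu> q" using split by simp
  have "(\<Sum>k. ?a (Suc k)) \<le> (\<Sum>k. ?b (Suc k))"
  proof (rule suminf_le[OF _ sa sb])
    fix k :: nat
    have ge1: "1 \<le> (fact (Suc k + \<nu>) :: real)" by (rule fact_ge_1)
    have "?a (Suc k) = ?b (Suc k) / fact (Suc k + \<nu>)" by (simp add: field_simps del: fact_Suc)
    also have "\<dots> \<le> ?b (Suc k) / 1"
      using ge1 assms by (intro divide_left_mono) (auto simp del: fact_Suc)
    finally show "?a (Suc k) \<le> ?b (Suc k)" by simp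
  qed
  also have "\<dots> = exp q - 1"
    using suminf_split_head[OF summable_exp_generic[of q]] by (simp add: exp_def)
  also have "\<dots> \<le> q * exp q"
    using mult_right_mono[OF exp_ge_add_one_self[of "- q"], of "exp q"] by (simp add: exp_minus algebra_simps)
  finally show "bessel_series \<nu> q \<le> 1 / fact \<nu> + q * exp q" using split by simp
qed

lemma p1_estimate:
  fixes Q :: real
  assumes n: "n \<ge> 1" and N: "n + k1 = Suc \<nu>" and Q: "0 \<le> Q"
  obtains K T where "0 < K" "1 < T"
    "\<And>(x :: 'a::real_normed_vector) t. T \<le> \<bar>t\<bar> \<Longrightarrow> pi * Rpar x * \<bar>t\<bar> \<le> Q \<Longrightarrow>
      norm (p1 n k1 k2 x t - of_real ((-1) ^ k2 * pi ^ (k1 + k2) / 4 ^ n * \<bar>t\<bar> ^ \<nu>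
          * exp (- pi * \<bar>t\<bar>) * bessel_series \<nu> (pi * Rpar x * \<bar>t\<bar>)))
      \<le> K * (exp (- pi * \<bar>t\<bar>) * \<bar>t\<bar> ^ \<nu> / \<bar>t\<bar>)"
proof -
  obtain K1 T where K1: "0 < K1" and T: "1 < T" and res:
    "\<And>R \<tau>. 0 \<le> R \<Longrightarrow> T \<le> \<tau> \<Longrightarrow> pi * R * \<tau> \<le> Q \<Longrightarrow>
      norm (2 * pi * \<i> * residue (heat_integrand R \<tau> n k1 k2) (\<i> * pi)
        - exp (- pi * \<tau>) * (pole_amplitude n k1 k2 0 * (2 * pi * \<i> * ((\<i> * \<tau>) ^ \<nu> * bessel_series \<nu> (of_real (pi * R * \<tau>))))))
      \<le> K1 * exp (- pi * \<tau>) * \<tau> ^ \<nu> / \<tau>"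
    using residue_estimate[OF N Q, of k2] by metis
  obtain B where B: "0 < B" and bound: "\<And>z. Im z = 0 \<or> Im z = 3 * pi / 2 \<or> 1 \<le> \<bar>Re z\<bar> \<and> \<bar>Im z\<bar> \<le> 5 \<Longrightarrow>
    norm (cosh z ^ k1 * z ^ k2 / sinhc z ^ (n + k1)) \<le> B / (1 + (Re z)\<^sup>2)"
    using amplitude_bound_exists[OF n, of k1 k2] by metis
  define c where "c = (-1) ^ k1 * \<i> ^ k2 / complex_of_real ((4 * pi) ^ n * (2 * pi))"
  define K where "K = norm c * (K1 + B * pi)"
  show ?thesis
  proof (rule that[of K T])
    show "0 < K" using K1 B by (auto simp: K_def c_def intro!: mult_pos_pos add_pos_pos)
    show "1 < T" by (rule T)
    fix x :: 'a and t :: real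
    assume t: "T \<le> \<bar>t\<bar>" and Q': "pi * Rpar x * \<bar>t\<bar> \<le> Q"
    define R \<tau> where "R = Rpar x" and "\<tau> = \<bar>t\<bar>"
    have tau: "1 < \<tau>" using t T by (simp add: \<tau>_def)
    have R: "0 \<le> R" by (simp add: R_def Rpar_def)
    define S where "S = bessel_series \<nu> (pi * R * \<tau>)"
    let ?I = "LBINT l. heat_integrand R \<tau> n k1 k2 (of_real l)"
    let ?r = "2 * pi * \<i> * residue (heat_integrand R \<tau> n k1 k2) (\<i> * pi)"
    let ?m = "exp (- pi * \<tau>) * (pole_amplitude n k1 k2 0 * (2 * pi * \<i> * ((\<i> * \<tau>) ^ \<nu> * bessel_series \<nu> (of_real (pi * R * \<tau>)))))"
    have "norm (?I - ?r) \<le> B * pi * exp (- (3 * pi / 2) * \<tau>)"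
      by (rule contour_shift[OF R _ B bound]) (use tau in auto)
    also have "\<dots> \<le> B * pi * (exp (- pi * \<tau>) * \<tau> ^ \<nu> / \<tau>)"
    proof (intro mult_left_mono)
      \<comment> \<open>The excess decay exp (-pi \<tau> / 2) of the upper line is weakened to
        1/\<tau>, so that the remainder fits the error of the residue.\<close>
      have "\<tau> \<le> exp (pi / 2 * \<tau>)"
      proof -
        have "\<tau> * 1 \<le> \<tau> * (pi / 2)" using tau pi_gt3 by (intro mult_left_mono) auto
        then show ?thesis using exp_ge_add_one_self[of "pi / 2 * \<tau>"] by (simp only: mult.commute)
      qed
      then have "exp (- (pi / 2 * \<tau>)) \<le> 1 / \<tau>" using tau by (simp add: exp_minus field_simps)
      moreover have "1 \<le> \<tau> ^ \<nu>" using tau by simp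
      ultimately have "exp (- (pi / 2 * \<tau>)) \<le> \<tau> ^ \<nu> / \<tau>"
        using tau by (meson divide_right_mono less_eq_real_def order_trans zero_less_one less_trans)
      then have "exp (- pi * \<tau>) * exp (- (pi / 2 * \<tau>)) \<le> exp (- pi * \<tau>) * (\<tau> ^ \<nu> / \<tau>)"
        by (intro mult_left_mono) auto
      moreover have "exp (- (3 * pi / 2) * \<tau>) = exp (- pi * \<tau>) * exp (- (pi / 2 * \<tau>))"
        by (simp add: exp_add[symmetric] field_simps)
      ultimately show "exp (- (3 * pi / 2) * \<tau>) \<le> exp (- pi * \<tau>) * \<tau> ^ \<nu> / \<tau>" by simp
    qed (use B in auto)
    finally have 1: "norm (?I - ?r) \<le> B * pi * (exp (- pi * \<tau>) * \<tau> ^ \<nu> / \<tau>)" .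
    have 2: "norm (?r - ?m) \<le> K1 * (exp (- pi * \<tau>) * \<tau> ^ \<nu> / \<tau>)"
      using res[OF R, of \<tau>] t Q' by (simp add: R_def \<tau>_def mult.assoc)
    have m: "c * ?m = of_real ((-1) ^ k2 * pi ^ (k1 + k2) / 4 ^ n * \<tau> ^ \<nu> * exp (- pi * \<tau>) * S)"
    proof -
      \<comment> \<open>The four powers of i come from the prefactor of \<open>p1\<close>, from the
        pole amplitude, from 2 pi i, and from (i \<tau>)^\<nu>. Together with the sign of
        \<open>- sinhc\<close> they leave (-1)^k2.\<close>
      have "(\<i>::complex) ^ k2 * \<i> ^ (k2 + Suc \<nu>) * \<i> * \<i> ^ \<nu> = (\<i> ^ 2) ^ (k2 + Suc \<nu>)"
        by (simp add: power_mult[symmetric] power_add[symmetric] mult_ac flip: power_Suc power_Suc2)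
          (simp add: power_add mult_ac power2_eq_square flip: power_mult_distrib)
      then have "(\<i>::complex) ^ k2 * \<i> ^ (k2 + Suc \<nu>) * \<i> * \<i> ^ \<nu> = (-1) ^ k2 * (-1) ^ Suc \<nu>"
        by (simp only: power2_i power_add)
      then have i: "(\<i>::complex) ^ k2 * \<i> ^ (k2 + Suc \<nu>) * \<i> * \<i> ^ \<nu> / (-1) ^ Suc \<nu> = (-1) ^ k2" by simp
      have H0: "pole_amplitude n k1 k2 0 = (-1) ^ k1 * (\<i> ^ (k2 + Suc \<nu>) * of_real (pi ^ (k2 + n + k1))) / (-1) ^ Suc \<nu>"
        unfolding pole_amplitude_def N by (simp add: power_mult_distrib N add.assoc)
      have "c * ?m = ((-1) ^ k1 * (-1) ^ k1) *
          (\<i> ^ k2 * \<i> ^ (k2 + Suc \<nu>) * \<i> * \<i> ^ \<nu> / (-1) ^ Suc \<nu>)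
          * of_real (pi ^ (k2 + n + k1) * (2 * pi) / ((4 * pi) ^ n * (2 * pi)) * \<tau> ^ \<nu> * exp (- pi * \<tau>) * S)"
        unfolding c_def H0 bessel_series_of_real S_def[symmetric] power_mult_distrib[of \<i>]
        by (simp add: mult_ac)
      also have "\<dots> = of_real ((-1) ^ k2 * pi ^ (k1 + k2) / 4 ^ n * \<tau> ^ \<nu> * exp (- pi * \<tau>) * S)"
        unfolding i by (simp add: power_add power_mult_distrib mult_ac flip: power2_eq_square)
          (simp add: power2_eq_square)
      finally show ?thesis .
    qed
    have p: "p1 n k1 k2 x t = c * ?I"
      by (simp only: p1_eq_heat_integrand[OF n] c_def R_def \<tau>_def)
    have "p1 n k1 k2 x t - of_real ((-1) ^ k2 * pi ^ (k1 + k2) / 4 ^ n * \<tau> ^ \<nu> * exp (- pi * \<tau>) * S)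
        = c * ((?I - ?r) + (?r - ?m))"
      unfolding p m[symmetric] by (simp only: add_diff_eq diff_add_cancel right_diff_distrib)
    also have "norm \<dots> \<le> norm c * (B * pi * (exp (- pi * \<tau>) * \<tau> ^ \<nu> / \<tau>) + K1 * (exp (- pi * \<tau>) * \<tau> ^ \<nu> / \<tau>))"
      unfolding norm_mult using 1 2 by (intro mult_left_mono norm_triangle_mono) auto
    also have "\<dots> = K * (exp (- pi * \<tau>) * \<tau> ^ \<nu> / \<tau>)" by (simp add: K_def algebra_simps add_divide_distrib)
    finally show "norm (p1 n k1 k2 x t - of_real ((-1) ^ k2 * pi ^ (k1 + k2) / 4 ^ n * \<bar>t\<bar> ^ \<nu>
          * exp (- pi * \<bar>t\<bar>) * bessel_series \<nu> (pi * Rpar x * \<bar>t\<bar>)))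
      \<le> K * (exp (- pi * \<bar>t\<bar>) * \<bar>t\<bar> ^ \<nu> / \<bar>t\<bar>)"
      unfolding S_def R_def \<tau>_def .
  qed
qed

section \<open>The two asymptotic regimes\<close>

lemma kappa_delta_relations:
  assumes "x \<noteq> 0" "t \<noteq> 0"
  shows "0 < delta_par x t" "0 < kappa_par x t" "0 < Rpar x"
    and "\<bar>t\<bar> * (2 * pi * delta_par x t) = kappa_par x t"
    and "2 * Rpar x = kappa_par x t * delta_par x t"
    and "pi * Rpar x * \<bar>t\<bar> = (kappa_par x t)\<^sup>2 / 4"
proof -
  define R \<tau> where "R = Rpar x" and "\<tau> = \<bar>t\<bar>"
  have pos: "0 < R" "0 < \<tau>" using assms by (auto simp: R_def \<tau>_def Rpar_def)
  have d: "delta_par x t = sqrt (R / (pi * \<tau>))" and k: "kappa_par x t = 2 * sqrt (pi * \<tau> * R)"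
    by (simp_all add: delta_par_def kappa_par_def R_def \<tau>_def)
  show "0 < delta_par x t" "0 < kappa_par x t" "0 < Rpar x"
    using pos by (simp_all add: d k flip: R_def)
  have pd: "pi * \<tau> * sqrt (R / (pi * \<tau>)) = sqrt (pi * \<tau> * R)"
  proof -
    have sq: "(sqrt (R / (pi * \<tau>)))\<^sup>2 = R / (pi * \<tau>)" using pos by simp
    have "(pi * \<tau> * sqrt (R / (pi * \<tau>)))\<^sup>2 = pi * \<tau> * R"
      unfolding power_mult_distrib sq using pos by (simp add: power2_eq_square)
    then show ?thesis using pos by (intro real_sqrt_unique[symmetric]) auto
  qed
  then show "\<bar>t\<bar> * (2 * pi * delta_par x t) = kappa_par x t"
    by (simp add: d k mult_ac flip: \<tau>_def)
  have "sqrt (pi * \<tau> * R) * sqrt (R / (pi * \<tau>)) = sqrt (R\<^sup>2)"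
    using pos by (simp add: real_sqrt_mult[symmetric] power2_eq_square del: real_sqrt_abs)
  then show "2 * Rpar x = kappa_par x t * delta_par x t"
    using pos by (simp add: d k flip: R_def)
  show "pi * Rpar x * \<bar>t\<bar> = (kappa_par x t)\<^sup>2 / 4"
    using pos by (simp add: k power_mult_distrib flip: R_def \<tau>_def)
qed

lemma abs_exp_minus_1_le:
  fixes v :: real
  assumes "\<bar>v\<bar> \<le> 1"
  shows "\<bar>exp v - 1\<bar> \<le> 3 * \<bar>v\<bar>"
proof (cases "0 \<le> v")
  case True
  have "exp v \<le> 3" using assms exp_le order_trans[of "exp v" "exp 1" 3] by simp
  have "exp v - 1 \<le> v * exp v"
    using mult_right_mono[OF exp_ge_add_one_self[of "- v"], of "exp v"] by (simp add: exp_minus algebra_simps)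
  also have "\<dots> \<le> v * 3" using True \<open>exp v \<le> 3\<close> by (intro mult_left_mono)
  finally show ?thesis using True by simp
next
  case False
  then have "\<bar>v\<bar> = - v" "\<bar>exp v - 1\<bar> = 1 - exp v" by simp_all
  then show ?thesis using exp_ge_add_one_self[of v] False by linarith
qed

lemma dist_d_exponent:
  fixes x :: "'a::real_normed_vector" and t :: real
  assumes "x \<noteq> 0" "t \<noteq> 0" "delta_par x t < 1 / pi"
  obtains u where "0 \<le> u" "u \<le> 5 * Rpar x" "(dist_d x t)\<^sup>2 / 4 = pi * \<bar>t\<bar> - kappa_par x t + u"
  using dist_d_bounds[OF assms] by (intro that[of "(dist_d x t)\<^sup>2 / 4 - (pi * \<bar>t\<bar> - kappa_par x t)"]) auto

text \<open>The lower bound on \<kappa> turns 1/|t| into O(\<delta>); the upper bound makes R, and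
  with it the discrepancy u in the exponent, O(\<delta>).\<close>

lemma bounded_kappa_asymptotics:
  fixes n k1 k2 :: nat and C :: real
  assumes n: "n \<ge> 1" and C: "C > 1"
  shows "\<exists>K \<epsilon>. \<epsilon> > 0 \<and> (\<forall>(x :: 'a::real_normed_vector) (t :: real).
        x \<noteq> 0 \<and> t \<noteq> 0 \<and> delta_par x t < \<epsilon> \<and>
        1 / C \<le> kappa_par x t \<and> kappa_par x t \<le> C \<longrightarrow>
        (let A = (-1) ^ k2 * pi ^ (k1 + k2) / (4 ^ n * (pi * delta_par x t) ^ (n + k1 - 1))
                 * exp (- (dist_d x t)\<^sup>2 / 4) * exp (- kappa_par x t)
                 * bessel_I (n + k1 - 1) (kappa_par x t)
         in norm (p1 n k1 k2 x t - complex_of_real A) \<le> K * delta_par x t * \<bar>A\<bar>))"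
proof -
  define \<nu> where "\<nu> = n + k1 - 1"
  have N: "n + k1 = Suc \<nu>" using n by (simp add: \<nu>_def)
  obtain K0 T where K0: "0 < K0" and T: "1 < T" and est:
    "\<And>(x :: 'a) t. T \<le> \<bar>t\<bar> \<Longrightarrow> pi * Rpar x * \<bar>t\<bar> \<le> C\<^sup>2 / 4 \<Longrightarrow>
      norm (p1 n k1 k2 x t - of_real ((-1) ^ k2 * pi ^ (k1 + k2) / 4 ^ n * \<bar>t\<bar> ^ \<nu>
          * exp (- pi * \<bar>t\<bar>) * bessel_series \<nu> (pi * Rpar x * \<bar>t\<bar>)))
      \<le> K0 * (exp (- pi * \<bar>t\<bar>) * \<bar>t\<bar> ^ \<nu> / \<bar>t\<bar>)"
    using p1_estimate[OF n N, of "C\<^sup>2 / 4" k2] by (metis divide_nonneg_pos zero_le_power2 zero_less_numeral)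
  define P where "P = (-1) ^ k2 * pi ^ (k1 + k2) / (4::real) ^ n"
  have P: "0 < \<bar>P\<bar>" by (simp add: P_def)
  \<comment> \<open>First term: exp u \<le> 3, 1/\<tau> \<le> 2 pi C \<delta>, and the Bessel series
    is at least 1/\<nu>!. Second term: 3 u \<le> (15/2) C \<delta>, rounded up.\<close>
  define K where "K = 6 * pi * C * K0 * fact \<nu> / \<bar>P\<bar> + 8 * C"
  \<comment> \<open>Ensures at once \<tau> \<ge> T, \<delta> < 1/pi and u \<le> 1.\<close>
  define \<epsilon> where "\<epsilon> = 1 / (2 * pi * C * T)"
  show ?thesis
  proof (rule exI[of _ K], rule exI[of _ \<epsilon>], intro conjI allI impI)
    show "0 < \<epsilon>" using C T by (simp add: \<epsilon>_def)
    fix x :: 'a and t :: real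
    assume "x \<noteq> 0 \<and> t \<noteq> 0 \<and> delta_par x t < \<epsilon> \<and> 1 / C \<le> kappa_par x t \<and> kappa_par x t \<le> C"
    then have xt: "x \<noteq> 0" "t \<noteq> 0" and de: "delta_par x t < \<epsilon>"
      and kap: "1 / C \<le> kappa_par x t" "kappa_par x t \<le> C" by auto
    define \<delta> \<kappa> R \<tau> where "\<delta> = delta_par x t" and "\<kappa> = kappa_par x t" and "R = Rpar x" and "\<tau> = \<bar>t\<bar>"
    note defs = \<delta>_def[symmetric] \<kappa>_def[symmetric] R_def[symmetric] \<tau>_def[symmetric]
    note rel = kappa_delta_relations[OF xt, unfolded defs]
    have tau: "0 < \<tau>" using xt by (simp add: \<tau>_def)
    have CT: "1 < C * T" using C T by (simp add: less_1_mult)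
    have "\<delta> * (2 * pi * C * T) < 1" using de C T by (simp add: defs \<epsilon>_def field_simps)
    then have dCT: "2 * pi * \<delta> * (C * T) < 1" by (simp add: mult_ac)
    have "2 * pi * \<delta> * 1 < 2 * pi * \<delta> * (C * T)" using CT rel by (intro mult_strict_left_mono) auto
    then have "2 * (pi * \<delta>) < 1" using dCT by linarith
    then have d1: "\<delta> < 1 / pi" using rel by (simp add: field_simps)
    have inv_tau: "1 / \<tau> \<le> 2 * pi * C * \<delta>"
    proof -
      have "1 \<le> C * \<kappa>" using kap C by (simp add: defs field_simps)
      also have "\<dots> = \<tau> * (2 * pi * C * \<delta>)" using rel(4) by (simp add: mult_ac)
      finally show ?thesis using tau by (simp add: field_simps)
    qed
    have "T \<le> \<tau>"
    proof -
      have "T * (1 / \<tau>) \<le> T * (2 * pi * C * \<delta>)" using inv_tau T by (intro mult_left_mono) auto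
      also have "\<dots> \<le> 1" using dCT by (simp add: mult_ac)
      finally show ?thesis using tau by (simp add: field_simps)
    qed
    have "\<kappa>\<^sup>2 \<le> C\<^sup>2" using rel kap C by (intro power_mono) (auto simp: defs)
    then have Q: "pi * R * \<tau> \<le> C\<^sup>2 / 4" using rel(6) by simp
    obtain u where u: "0 \<le> u" "u \<le> 5 * R" and D: "(dist_d x t)\<^sup>2 / 4 = pi * \<tau> - \<kappa> + u"
      using dist_d_exponent[OF xt] d1 by (metis defs)
    have "2 * R \<le> C * \<delta>" using rel kap by (simp add: defs mult_right_mono)
    then have u': "u \<le> 5 / 2 * (C * \<delta>)" using u by linarith
    have "2 * 3 * \<delta> * (C * 1) \<le> 2 * pi * \<delta> * (C * T)"
      using pi_gt3 T C rel by (intro mult_mono) auto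
    then have "6 * (C * \<delta>) \<le> 1" using dCT by (simp add: mult_ac)
    then have u1: "u \<le> 1" using u' by linarith
    define S where "S = bessel_series \<nu> (pi * R * \<tau>)"
    define E where "E = exp (- (dist_d x t)\<^sup>2 / 4) * exp (- \<kappa>)"
    define A where "A = P * \<tau> ^ \<nu> * E * S"
    have S: "1 / fact \<nu> \<le> S" unfolding S_def using rel tau by (intro bessel_series_bounds(1)) auto
    then have Spos: "0 < S" by (rule less_le_trans[rotated]) simp
    have E: "0 < E" by (simp add: E_def)
    have expE: "exp (- pi * \<tau>) = E * exp u"
    proof -
      have "- pi * \<tau> = - (dist_d x t)\<^sup>2 / 4 + - \<kappa> + u" using D by linarith
      then show ?thesis by (simp only: E_def exp_add)
    qed
    have A_eq: "(-1) ^ k2 * pi ^ (k1 + k2) / (4 ^ n * (pi * \<delta>) ^ \<nu>)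
                 * exp (- (dist_d x t)\<^sup>2 / 4) * exp (- \<kappa>) * bessel_I \<nu> \<kappa> = A"
    proof -
      \<comment> \<open>The power (\<kappa>/2)^\<nu> inside the Bessel function and the prefactor
        (pi \<delta>)^-\<nu> combine to \<tau>^\<nu>.\<close>
      have "\<kappa> / 2 / (pi * \<delta>) = \<tau>" using rel(1,4) by (simp add: field_simps)
      then have "\<tau> ^ \<nu> = (\<kappa> / 2) ^ \<nu> / (pi * \<delta>) ^ \<nu>" by (simp only: power_divide[symmetric])
      then show ?thesis unfolding bessel_I_eq A_def E_def P_def S_def rel(6)
        by (simp only:) (simp add: field_simps)
    qed
    have absA: "\<bar>A\<bar> = \<bar>P\<bar> * \<tau> ^ \<nu> * E * S" using tau E Spos by (simp add: A_def abs_mult)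
    have lowA: "E * \<tau> ^ \<nu> \<le> fact \<nu> / \<bar>P\<bar> * \<bar>A\<bar>"
    proof -
      have "E * \<tau> ^ \<nu> * 1 \<le> E * \<tau> ^ \<nu> * (fact \<nu> * S)"
        using S E tau by (intro mult_left_mono) (auto simp: field_simps)
      also have "\<dots> = fact \<nu> / \<bar>P\<bar> * \<bar>A\<bar>" using P by (simp add: absA)
      finally show ?thesis by simp
    qed
    have eu: "\<bar>exp u - 1\<bar> \<le> 3 * u" using abs_exp_minus_1_le[of u] u u1 by simp
    have "exp u \<le> exp 1" using u1 by simp
    then have eu3: "exp u \<le> 3" using exp_le by linarith
    have "norm (p1 n k1 k2 x t - of_real (P * \<tau> ^ \<nu> * exp (- pi * \<tau>) * S))
        \<le> K0 * (exp (- pi * \<tau>) * \<tau> ^ \<nu> / \<tau>)"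
      using est[of t x] \<open>T \<le> \<tau>\<close> Q by (simp add: P_def S_def defs)
    also have "\<dots> = K0 * (exp u * (E * \<tau> ^ \<nu>) * (1 / \<tau>))" unfolding expE by (simp add: mult_ac)
    also have "\<dots> \<le> K0 * (3 * (fact \<nu> / \<bar>P\<bar> * \<bar>A\<bar>) * (2 * pi * C * \<delta>))"
      by (rule mult_left_mono[OF mult_mono[OF mult_mono[OF eu3 lowA] inv_tau]])
        (use K0 E tau in auto)
    finally have 1: "norm (p1 n k1 k2 x t - of_real (P * \<tau> ^ \<nu> * exp (- pi * \<tau>) * S))
        \<le> 6 * pi * C * K0 * fact \<nu> / \<bar>P\<bar> * \<delta> * \<bar>A\<bar>" by (simp add: mult_ac)
    have "P * \<tau> ^ \<nu> * exp (- pi * \<tau>) * S - A = A * (exp u - 1)"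
      unfolding expE by (simp add: A_def algebra_simps)
    then have "\<bar>P * \<tau> ^ \<nu> * exp (- pi * \<tau>) * S - A\<bar> = \<bar>A\<bar> * \<bar>exp u - 1\<bar>" by (simp add: abs_mult)
    also have "\<dots> \<le> \<bar>A\<bar> * (8 * C * \<delta>)"
    proof (rule mult_left_mono)
      have "0 \<le> C * \<delta>" using C rel by simp
      then show "\<bar>exp u - 1\<bar> \<le> 8 * C * \<delta>" using eu u' by linarith
    qed simp
    finally have 2: "norm (of_real (P * \<tau> ^ \<nu> * exp (- pi * \<tau>) * S) - complex_of_real A) \<le> 8 * C * \<delta> * \<bar>A\<bar>"
      unfolding of_real_diff[symmetric] norm_of_real by (simp add: mult_ac)
    have "norm (p1 n k1 k2 x t - of_real A)
        \<le> 6 * pi * C * K0 * fact \<nu> / \<bar>P\<bar> * \<delta> * \<bar>A\<bar> + 8 * C * \<delta> * \<bar>A\<bar>"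
      by (rule norm_diff_triangle_le[OF 1 2])
    then have "norm (p1 n k1 k2 x t - of_real A) \<le> K * \<delta> * \<bar>A\<bar>"
      by (simp add: K_def algebra_simps)
    then show "let A = (-1) ^ k2 * pi ^ (k1 + k2) / (4 ^ n * (pi * delta_par x t) ^ (n + k1 - 1))
                 * exp (- (dist_d x t)\<^sup>2 / 4) * exp (- kappa_par x t)
                 * bessel_I (n + k1 - 1) (kappa_par x t)
         in norm (p1 n k1 k2 x t - complex_of_real A) \<le> K * delta_par x t * \<bar>A\<bar>"
      unfolding Let_def defs \<nu>_def[symmetric] A_eq .
  qed
qed

text \<open>Without a lower bound on \<kappa> the error 1/|t| stands on its own. The factor exp
  (-\<kappa>) and the Bessel series are replaced by their values at \<kappa> = 0, each at relative
  cost O(\<kappa>).\<close>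

lemma small_kappa_asymptotics:
  fixes n k1 k2 :: nat
  assumes n: "n \<ge> 1"
  shows "\<exists>K \<epsilon> T. \<epsilon> > 0 \<and> (\<forall>(x :: 'a::real_normed_vector) (t :: real).
        0 < kappa_par x t \<and> kappa_par x t < \<epsilon> \<and> \<bar>t\<bar> > T \<longrightarrow>
        (let B = (-1) ^ k2 * pi ^ (k1 + k2) / (4 ^ n * fact (n + k1 - 1))
                 * \<bar>t\<bar> ^ (n + k1 - 1) * exp (- (dist_d x t)\<^sup>2 / 4)
         in norm (p1 n k1 k2 x t - complex_of_real B) \<le> K * (1 / \<bar>t\<bar> + kappa_par x t) * \<bar>B\<bar>))"
proof -
  define \<nu> where "\<nu> = n + k1 - 1"
  have N: "n + k1 = Suc \<nu>" using n by (simp add: \<nu>_def)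
  obtain K0 T where K0: "0 < K0" and T: "1 < T" and est:
    "\<And>(x :: 'a) t. T \<le> \<bar>t\<bar> \<Longrightarrow> pi * Rpar x * \<bar>t\<bar> \<le> 1 \<Longrightarrow>
      norm (p1 n k1 k2 x t - of_real ((-1) ^ k2 * pi ^ (k1 + k2) / 4 ^ n * \<bar>t\<bar> ^ \<nu>
          * exp (- pi * \<bar>t\<bar>) * bessel_series \<nu> (pi * Rpar x * \<bar>t\<bar>)))
      \<le> K0 * (exp (- pi * \<bar>t\<bar>) * \<bar>t\<bar> ^ \<nu> / \<bar>t\<bar>)"
    using p1_estimate[OF n N, of 1 k2] by (metis zero_le_one)
  define P where "P = (-1) ^ k2 * pi ^ (k1 + k2) / (4::real) ^ n"
  have P: "0 < \<bar>P\<bar>" by (simp add: P_def)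
  \<comment> \<open>Here 3 bounds exp v; the 6 collects 3 \<kappa> from the Bessel series and 3
    \<kappa> from exp v - 1.\<close>
  define K where "K = 3 * K0 * fact \<nu> / \<bar>P\<bar> + 6 * fact \<nu>"
  have Kparts: "0 \<le> 3 * K0 * fact \<nu> / \<bar>P\<bar>" using K0 by simp
  show ?thesis
  proof (rule exI[of _ K], rule exI[of _ 1], rule exI[of _ T], intro conjI allI impI)
    show "(0::real) < 1" by simp
    fix x :: 'a and t :: real
    assume *: "0 < kappa_par x t \<and> kappa_par x t < 1 \<and> T < \<bar>t\<bar>"
    \<comment> \<open>Positivity of \<kappa> excludes the degenerate cases of
      \<open>dist_d\<close>.\<close>
    then have xt: "x \<noteq> 0" "t \<noteq> 0" by (auto simp: kappa_par_def Rpar_def)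
    define \<delta> \<kappa> R \<tau> where "\<delta> = delta_par x t" and "\<kappa> = kappa_par x t" and "R = Rpar x" and "\<tau> = \<bar>t\<bar>"
    note defs = \<delta>_def[symmetric] \<kappa>_def[symmetric] R_def[symmetric] \<tau>_def[symmetric]
    note rel = kappa_delta_relations[OF xt, unfolded defs]
    have kap: "0 < \<kappa>" "\<kappa> < 1" and tau: "T < \<tau>" "1 < \<tau>" using * T by (auto simp: defs)
    \<comment> \<open>Since |t| > 1, \<delta> is controlled by \<kappa>; this yields both the
      smallness needed for the distance bounds and 5 R \<le> \<kappa>.\<close>
    have "1 * (2 * pi * \<delta>) \<le> \<tau> * (2 * pi * \<delta>)" using tau rel by (intro mult_right_mono) auto
    then have pd: "2 * pi * \<delta> \<le> \<kappa>" using rel(4) by simp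
    then have d1: "\<delta> < 1 / pi" using kap rel by (simp add: field_simps)
    have "2 * 3 * \<delta> \<le> 2 * pi * \<delta>" using rel pi_gt3 by (intro mult_right_mono) auto
    then have d6: "6 * \<delta> \<le> \<kappa>" using pd by linarith
    have "\<kappa> * \<delta> \<le> 1 * \<delta>" using kap rel by (intro mult_right_mono) auto
    then have R5: "5 * R \<le> \<kappa>" using rel(5) d6 rel(1) by linarith
    have "\<kappa>\<^sup>2 \<le> \<kappa>" using kap by (simp add: power2_eq_square mult_left_le)
    then have q: "pi * R * \<tau> \<le> \<kappa> / 4" using rel(6) by simp
    obtain u where u: "0 \<le> u" "u \<le> 5 * R" and D: "(dist_d x t)\<^sup>2 / 4 = pi * \<tau> - \<kappa> + u"
      using dist_d_exponent[OF xt] d1 by (metis defs)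
    define v where "v = u - \<kappa>"
    have v: "\<bar>v\<bar> \<le> \<kappa>" using u R5 by (simp add: v_def)
    define S where "S = bessel_series \<nu> (pi * R * \<tau>)"
    define E where "E = exp (- (dist_d x t)\<^sup>2 / 4)"
    define B where "B = P / fact \<nu> * \<tau> ^ \<nu> * E"
    have q0: "0 \<le> pi * R * \<tau>" using rel tau by simp
    have "exp v \<le> exp 1" using v kap by simp
    then have ev3: "exp v \<le> 3" using exp_le by linarith
    have ev: "\<bar>exp v - 1\<bar> \<le> 3 * \<kappa>" using abs_exp_minus_1_le[of v] v kap by linarith
    have S: "0 \<le> S - 1 / fact \<nu>" "S - 1 / fact \<nu> \<le> \<kappa>"
    proof -
      have "exp (pi * R * \<tau>) \<le> exp 1" using q kap by simp
      then have "exp (pi * R * \<tau>) \<le> 3" using exp_le by linarith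
      then have "pi * R * \<tau> * exp (pi * R * \<tau>) \<le> \<kappa> / 4 * 3" using q q0 kap by (intro mult_mono) auto
      then show "S - 1 / fact \<nu> \<le> \<kappa>" using bessel_series_bounds(2)[OF q0, of \<nu>] kap by (simp add: S_def)
      show "0 \<le> S - 1 / fact \<nu>" using bessel_series_bounds(1)[OF q0, of \<nu>] by (simp add: S_def)
    qed
    have E: "0 < E" by (simp add: E_def)
    have expE: "exp (- pi * \<tau>) = E * exp v"
    proof -
      have "- pi * \<tau> = - (dist_d x t)\<^sup>2 / 4 + v" using D unfolding v_def by linarith
      then show ?thesis by (simp only: E_def exp_add)
    qed
    have absB: "\<bar>B\<bar> = \<bar>P\<bar> / fact \<nu> * \<tau> ^ \<nu> * E" using tau E by (simp add: B_def abs_mult)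
    have EB: "E * \<tau> ^ \<nu> = fact \<nu> / \<bar>P\<bar> * \<bar>B\<bar>" using P by (simp add: absB)
    have "norm (p1 n k1 k2 x t - of_real (P * \<tau> ^ \<nu> * exp (- pi * \<tau>) * S))
        \<le> K0 * (exp (- pi * \<tau>) * \<tau> ^ \<nu> / \<tau>)"
      using est[of t x] tau q kap by (simp add: P_def S_def defs)
    also have "\<dots> = K0 * (exp v * (fact \<nu> / \<bar>P\<bar> * \<bar>B\<bar>) * (1 / \<tau>))" unfolding EB[symmetric] expE by (simp add: mult_ac)
    also have "\<dots> \<le> K0 * (3 * (fact \<nu> / \<bar>P\<bar> * \<bar>B\<bar>) * (1 / \<tau>))"
      using K0 ev3 tau by (intro mult_left_mono mult_right_mono) auto
    finally have 1: "norm (p1 n k1 k2 x t - of_real (P * \<tau> ^ \<nu> * exp (- pi * \<tau>) * S))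
        \<le> 3 * K0 * fact \<nu> / \<bar>P\<bar> * (1 / \<tau>) * \<bar>B\<bar>" by (simp add: mult_ac)
    have "P * \<tau> ^ \<nu> * exp (- pi * \<tau>) * S - B
        = P * \<tau> ^ \<nu> * E * ((S - 1 / fact \<nu>) * exp v + 1 / fact \<nu> * (exp v - 1))"
      unfolding expE by (simp add: B_def algebra_simps diff_divide_distrib)
    then have "\<bar>P * \<tau> ^ \<nu> * exp (- pi * \<tau>) * S - B\<bar>
        = fact \<nu> * \<bar>B\<bar> * \<bar>(S - 1 / fact \<nu>) * exp v + 1 / fact \<nu> * (exp v - 1)\<bar>"
      using tau E by (simp add: absB abs_mult)
    also have "\<dots> \<le> fact \<nu> * \<bar>B\<bar> * (6 * \<kappa>)"
    proof (rule mult_left_mono)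
      have "\<bar>(S - 1 / fact \<nu>) * exp v\<bar> \<le> \<kappa> * 3"
        unfolding abs_mult using S ev3 by (intro mult_mono) auto
      moreover have "\<bar>1 / fact \<nu> * (exp v - 1)\<bar> \<le> 1 * (3 * \<kappa>)"
        unfolding abs_mult using ev by (intro mult_mono) (auto simp: fact_ge_1)
      ultimately show "\<bar>(S - 1 / fact \<nu>) * exp v + 1 / fact \<nu> * (exp v - 1)\<bar> \<le> 6 * \<kappa>" by linarith
    qed simp
    finally have 2: "norm (of_real (P * \<tau> ^ \<nu> * exp (- pi * \<tau>) * S) - complex_of_real B) \<le> 6 * fact \<nu> * \<kappa> * \<bar>B\<bar>"
      unfolding of_real_diff[symmetric] norm_of_real by (simp add: mult_ac)
    have "norm (p1 n k1 k2 x t - of_real B)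
        \<le> 3 * K0 * fact \<nu> / \<bar>P\<bar> * (1 / \<tau>) * \<bar>B\<bar> + 6 * fact \<nu> * \<kappa> * \<bar>B\<bar>"
      by (rule norm_diff_triangle_le[OF 1 2])
    also have "\<dots> \<le> K * (1 / \<tau> + \<kappa>) * \<bar>B\<bar>"
    proof -
      have "0 \<le> 3 * K0 * fact \<nu> / \<bar>P\<bar> * \<kappa> * \<bar>B\<bar>" "0 \<le> 6 * fact \<nu> * (1 / \<tau>) * \<bar>B\<bar>"
        using Kparts K0 kap tau by (auto intro!: mult_nonneg_nonneg)
      then show ?thesis unfolding K_def distrib_left distrib_right by linarith
    qed
    finally have fin: "norm (p1 n k1 k2 x t - of_real B) \<le> K * (1 / \<tau> + \<kappa>) * \<bar>B\<bar>" .
    have B_eq: "(-1) ^ k2 * pi ^ (k1 + k2) / (4 ^ n * fact \<nu>) * \<tau> ^ \<nu> * exp (- (dist_d x t)\<^sup>2 / 4) = B"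
      by (simp add: B_def P_def E_def)
    show "let B = (-1) ^ k2 * pi ^ (k1 + k2) / (4 ^ n * fact (n + k1 - 1))
                 * \<bar>t\<bar> ^ (n + k1 - 1) * exp (- (dist_d x t)\<^sup>2 / 4)
         in norm (p1 n k1 k2 x t - complex_of_real B) \<le> K * (1 / \<bar>t\<bar> + kappa_par x t) * \<bar>B\<bar>"
      using fin unfolding Let_def defs \<nu>_def[symmetric] B_eq .
  qed
qed

theorem theorem3p11:
  fixes n k1 k2 :: nat and C :: real
  assumes "n \<ge> 1" and "C > 1" and "CARD('d::finite) = 2 * n"
  shows
   "(\<exists>K \<epsilon>. \<epsilon> > 0 \<and> (\<forall>(x :: real ^ 'd) (t :: real).
        x \<noteq> 0 \<and> t \<noteq> 0 \<and> delta_par x t < \<epsilon> \<and>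
        1 / C \<le> kappa_par x t \<and> kappa_par x t \<le> C \<longrightarrow>
        (let A = (-1) ^ k2 * pi ^ (k1 + k2) / (4 ^ n * (pi * delta_par x t) ^ (n + k1 - 1))
                 * exp (- (dist_d x t)\<^sup>2 / 4) * exp (- kappa_par x t)
                 * bessel_I (n + k1 - 1) (kappa_par x t)
         in norm (p1 n k1 k2 x t - complex_of_real A) \<le> K * delta_par x t * \<bar>A\<bar>)))
    \<and>
    (\<exists>K \<epsilon> T. \<epsilon> > 0 \<and> (\<forall>(x :: real ^ 'd) (t :: real).
        0 < kappa_par x t \<and> kappa_par x t < \<epsilon> \<and> \<bar>t\<bar> > T \<longrightarrow>
        (let B = (-1) ^ k2 * pi ^ (k1 + k2) / (4 ^ n * fact (n + k1 - 1))
                 * \<bar>t\<bar> ^ (n + k1 - 1) * exp (- (dist_d x t)\<^sup>2 / 4)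
         in norm (p1 n k1 k2 x t - complex_of_real B) \<le> K * (1 / \<bar>t\<bar> + kappa_par x t) * \<bar>B\<bar>)))"
  using bounded_kappa_asymptotics[OF assms(1,2)] small_kappa_asymptotics[OF assms(1)] by (rule conjI)

end
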